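(* Let $d\ge1$, $0<\beta\le2$, $1\le p,q\le\infty$, $s\in\mathbb{R}$, and $\alpha=1-\beta/2\in[0,1)$. If $$\|S_\beta(t)u\|_{L^p(I\times\mathbb{R}^d)}\le C\|u\|_{M^{s,\alpha}_{p,q}}\quad\text{for all }u\in M^{s,\alpha}_{p,q},$$ then $$s\ge \max\Big\{0,\ \frac{\beta d}{2}\Big(\frac1p-\frac1q\Big),\ \frac{\beta d}{2}\Big(1-\frac1p-\frac1q\Big)-\frac\beta p\Big\}.$$
   Context: $I=[0,1]$. For $\beta>0$, $S_\beta(t)=\mathcal{F}^{-1}e^{it|\xi|^\beta}\mathcal{F}$ on $\mathbb{R}^d$. $\langle x\rangle=(1+|x|^2)^{1/2}$. $\alpha$-modulation spaces: for $\alpha\in[0,1)$ let $\{\eta_k^\alpha\}_{k\in\mathbb{Z}^d}$ be Schwartz functions with $|\eta_k^\alpha(\xi)|\gtrsim1$ if $|\xi-\langle k\rangle^{\alpha/(1-\alpha)}k|<c\langle k\rangle^{\alpha/(1-\alpha)}$, $\operatorname{supp}\eta_k^\alpha\subseteq\{\xi:|\xi-\langle k\rangle^{\alpha/(1-\alpha)}k|<C\langle k\rangle^{\alpha/(1-\alpha)}\}$, $\sum_k\eta_k^\alpha\equiv1$, $|\partial^\gamma\eta_k^\alpha|\le C_{\alpha,\gamma}\langle k\rangle^{-\alpha|\gamma|/(1-\alpha)}$. Set $\Box_k^\alpha=\mathcal{F}^{-1}\eta_k^\alpha\mathcal{F}$ and $\|f\|_{M^{s,\alpha}_{p,q}}=\big(\sum_{k}\langle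 k\rangle^{sq/(1-\alpha)}\|\Box_k^\alpha f\|_{L^p}^q\big)^{1/q}$ (usual modification for $q=\infty$). *)

theory Defs
  imports "HOL-Analysis.Analysis" "HOL-Probability.Essential_Supremum"
begin

definition recip :: "ereal \<Rightarrow> real" where
  "recip p = (if p = \<infinity> then 0 else 1 / real_of_ereal p)"

definition epowr :: "ennreal \<Rightarrow> real \<Rightarrow> ennreal" where
  "epowr x r = (if x = \<infinity> then \<infinity> else ennreal (enn2real x powr r))"

definition Lp_norm :: "'a measure \<Rightarrow> ereal \<Rightarrow> ('a \<Rightarrow> complex) \<Rightarrow> ennreal" where
  "Lp_norm M p f =
     (if p = \<infinity> then esssup M (\<lambda>x. ennreal (norm (f x)))
      else epowr (\<integral>\<^sup>+ x. ennreal (norm (f x) powr real_of_ereal p) \<partial>M) (1 / real_of_ereal p))"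

definition jbr :: "real ^ 'n \<Rightarrow> real" where
  "jbr x = sqrt (1 + (norm x)\<^sup>2)"

definition int_vec :: "int ^ 'n \<Rightarrow> real ^ 'n" where
  "int_vec k = (\<chi> i. of_int (k $ i))"

definition fourier :: "(real ^ 'n \<Rightarrow> complex) \<Rightarrow> real ^ 'n \<Rightarrow> complex" where
  "fourier f \<xi> = (\<integral> x. cis (- (x \<bullet> \<xi>)) * f x \<partial>lborel)"

definition inv_fourier :: "(real ^ 'n \<Rightarrow> complex) \<Rightarrow> real ^ 'n \<Rightarrow> complex" where
  "inv_fourier g x = complex_of_real ((2 * pi) powr (- real CARD('n))) *
                      (\<integral> \<xi>. cis (x \<bullet> \<xi>) * g \<xi> \<partial>lborel)"

definition fmult :: "(real ^ 'n \<Rightarrow> complex) \<Rightarrow> (real ^ 'n \<Rightarrow> complex) \<Rightarrow> real ^ 'n \<Rightarrow> complex" where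
  "fmult m u = inv_fourier (\<lambda>\<xi>. m \<xi> * fourier u \<xi>)"

definition S_beta :: "real \<Rightarrow> real \<Rightarrow> (real ^ 'n \<Rightarrow> complex) \<Rightarrow> real ^ 'n \<Rightarrow> complex" where
  "S_beta \<beta> t u = fmult (\<lambda>\<xi>. cis (t * norm \<xi> powr \<beta>)) u"

primrec pd :: "'n list \<Rightarrow> (real ^ 'n \<Rightarrow> complex) \<Rightarrow> real ^ 'n \<Rightarrow> complex" where
  "pd [] f = f"
| "pd (i # is) f = (\<lambda>x. frechet_derivative (pd is f) (at x) (axis i 1))"

definition smooth :: "(real ^ 'n \<Rightarrow> complex) \<Rightarrow> bool" where
  "smooth f \<longleftrightarrow> (\<forall>is x. pd is f differentiable (at x))"

text \<open>Admissible bounded alpha-partition of unity {eta_k}_{k in Z^d} (alpha in [0,1)).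
  Each eta_k is smooth with compact support, hence a Schwartz function.\<close>
definition alpha_BAPU :: "real \<Rightarrow> (int ^ 'n \<Rightarrow> real ^ 'n \<Rightarrow> complex) \<Rightarrow> bool" where
  "alpha_BAPU \<alpha> \<eta> \<longleftrightarrow>
     (let a = \<alpha> / (1 - \<alpha>); ctr = (\<lambda>k. jbr (int_vec k) powr a *\<^sub>R int_vec k) in
      (\<forall>k. smooth (\<eta> k)) \<and>
      (\<exists>c c0 C. c > 0 \<and> c0 > 0 \<and> C > 0 \<and>
         (\<forall>k \<xi>. dist \<xi> (ctr k) < c * jbr (int_vec k) powr a \<longrightarrow> norm (\<eta> k \<xi>) \<ge> c0) \<and>
         (\<forall>k. closure {\<xi>. \<eta> k \<xi> \<noteq> 0} \<subseteq> ball (ctr k) (C * jbr (int_vec k) powr a))) \<and>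
      (\<forall>\<xi>. ((\<lambda>k. \<eta> k \<xi>) has_sum 1) UNIV) \<and>
      (\<forall>\<gamma>. \<exists>C\<gamma>. \<forall>k \<xi>.
         norm (pd \<gamma> (\<eta> k) \<xi>) \<le> C\<gamma> * jbr (int_vec k) powr (- \<alpha> * real (length \<gamma>) / (1 - \<alpha>))))"

definition mod_norm :: "(int ^ 'n \<Rightarrow> real ^ 'n \<Rightarrow> complex) \<Rightarrow> real \<Rightarrow> real \<Rightarrow> ereal \<Rightarrow> ereal
                         \<Rightarrow> (real ^ 'n \<Rightarrow> complex) \<Rightarrow> ennreal" where
  "mod_norm \<eta> \<alpha> s p q u =
     (if q = \<infinity> then
        (SUP k. ennreal (jbr (int_vec k) powr (s / (1 - \<alpha>))) * Lp_norm lborel p (fmult (\<eta> k) u))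
      else epowr (\<integral>\<^sup>+ k. ennreal (jbr (int_vec k) powr (s * real_of_ereal q / (1 - \<alpha>)))
                          * epowr (Lp_norm lborel p (fmult (\<eta> k) u)) (real_of_ereal q)
                        \<partial>count_space UNIV) (1 / real_of_ereal q))"

definition st_norm :: "ereal \<Rightarrow> (real \<Rightarrow> real ^ 'n \<Rightarrow> complex) \<Rightarrow> ennreal" where
  "st_norm p F = Lp_norm (restrict_space lborel ({0..1} \<times> UNIV)) p (\<lambda>(t, x). F t x)"

end

theory Submission
  imports Defs "HOL-Probability.Sinc_Integral" "HOL-Probability.Characteristic_Functions"
    "HOL-Real_Asymp.Real_Asymp"
begin

text \<open>
  Test functions are superpositions of packets whose Fourier transforms are \<open>\<bar>\<eta>\<^sub>k\<bar>\<^sup>2\<close>, with signs and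
  translations, over a set \<open>K\<close> of indices \<open>k\<close> of size comparable to \<open>N\<close>. Such a packet lives at frequency scale
  \<open>N\<^sup>a\<close> with \<open>a = 2 / \<beta> - 1\<close>; integration by parts and interpolation between the sup norm and
  the \<open>L\<^sup>1\<close> norm bound the modulation norm by \<open>N\<close> to the power
  \<open>2 s / \<beta> + a d (1 - 1 / p)\<close> times the \<open>q\<close>-th root of \<open>card K\<close>.

  For the first two conditions the packets are translated far apart. For short times the phase is affine on the
  support of each of them up to a small error, so each moves rigidly along a tube, and averaging over
  the signs shows that for some choice of signs the contributions of the disjoint tubes add up.
  Taking \<open>K\<close> a single index, respectively all indices of a cube, gives the two conditions.
  For the third condition (and for \<open>p = \<infinity>\<close>) all packets are placed in phase at the origin, where they
  add up constructively for times up to order \<open>N\<^sup>-\<^sup>2\<close>.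
\<close>


section \<open>Derivative bounds and integration by parts\<close>

lemma pd_append: "pd (is @ js) f = pd is (pd js f)"
  by (induction "is") simp_all

definition deriv_bound :: "real \<Rightarrow> real \<Rightarrow> nat \<Rightarrow> (real ^ 'n \<Rightarrow> complex) \<Rightarrow> bool" where
  "deriv_bound A r m f \<longleftrightarrow>
     (\<forall>is x. length is \<le> m \<longrightarrow> pd is f differentiable (at x) \<and> norm (pd is f x) \<le> A * r ^ length is)"

lemma deriv_bound_nonneg: "deriv_bound A r m f \<Longrightarrow> 0 \<le> A"
  unfolding deriv_bound_def using order_trans[OF norm_ge_zero] by (fastforce dest!: spec[of _ "[]"])

lemma deriv_bound_differentiable: "deriv_bound A r m f \<Longrightarrow> f differentiable (at x)"
  unfolding deriv_bound_def by (auto dest!: spec[of _ "[]"])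

lemma deriv_bound_norm: "deriv_bound A r m f \<Longrightarrow> norm (f x) \<le> A"
  unfolding deriv_bound_def by (auto dest!: spec[of _ "[]"])

lemma deriv_bound_mono:
  assumes "deriv_bound A r m f" "m' \<le> m" "A \<le> A'" "0 \<le> r"
  shows "deriv_bound A' r m' f"
  unfolding deriv_bound_def
proof (intro allI impI)
  fix "is" :: "'a list" and x
  assume "length is \<le> m'"
  then have "pd is f differentiable at x \<and> norm (pd is f x) \<le> A * r ^ length is"
    using assms unfolding deriv_bound_def by auto
  moreover have "A * r ^ length is \<le> A' * r ^ length is"
    using assms by (intro mult_right_mono) auto
  ultimately show "pd is f differentiable at x \<and> norm (pd is f x) \<le> A' * r ^ length is"
    by auto
qed

lemma deriv_bound_pd:
  assumes "deriv_bound A r (Suc m) f"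
  shows "deriv_bound (A * r) r m (pd [i] f)"
  unfolding deriv_bound_def
proof (intro allI impI)
  fix "is" :: "'a list" and x
  assume "length is \<le> m"
  then have "length (is @ [i]) \<le> Suc m" by simp
  then have "pd (is @ [i]) f differentiable at x \<and> norm (pd (is @ [i]) f x) \<le> A * r ^ length (is @ [i])"
    using assms unfolding deriv_bound_def by blast
  then show "pd is (pd [i] f) differentiable at x \<and> norm (pd is (pd [i] f) x) \<le> A * r * r ^ length is"
    unfolding pd_append by (simp add: mult.assoc)
qed

lemma deriv_bound_add:
  assumes f: "deriv_bound A r m f" and g: "deriv_bound B r m g"
  shows "deriv_bound (A + B) r m (\<lambda>x. f x + g x)"
proof -
  have pd_add: "pd is (\<lambda>x. f x + g x) = (\<lambda>x. pd is f x + pd is g x)" if "length is \<le> m" for "is"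
    using that
  proof (induction "is")
    case (Cons i "is")
    have "pd is f differentiable at x" "pd is g differentiable at x" for x
      using f g Cons.prems unfolding deriv_bound_def by auto
    then have "((\<lambda>x. pd is f x + pd is g x) has_derivative
       (\<lambda>h. frechet_derivative (pd is f) (at x) h + frechet_derivative (pd is g) (at x) h)) (at x)" for x
      by (intro has_derivative_add) (auto simp: frechet_derivative_works)
    from frechet_derivative_at[OF this]
    have "frechet_derivative (\<lambda>x. pd is f x + pd is g x) (at x) =
       (\<lambda>h. frechet_derivative (pd is f) (at x) h + frechet_derivative (pd is g) (at x) h)" for x
      by simp
    then show ?case
      using Cons by simp
  qed simp
  show ?thesis
    unfolding deriv_bound_def
  proof (intro allI impI)
    fix "is" :: "'a list" and x
    assume l: "length is \<le> m"
    then have *: "pd is f differentiable at x \<and> norm (pd is f x) \<le> A * r ^ length is"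
      "pd is g differentiable at x \<and> norm (pd is g x) \<le> B * r ^ length is"
      using f g unfolding deriv_bound_def by auto
    then show "pd is (\<lambda>x. f x + g x) differentiable at x \<and>
        norm (pd is (\<lambda>x. f x + g x) x) \<le> (A + B) * r ^ length is"
      unfolding pd_add[OF l] by (auto simp: distrib_right intro: norm_triangle_le)
  qed
qed

lemma pd_mult1:
  assumes "\<And>x. f differentiable (at x)" "\<And>x. g differentiable (at x)"
  shows "pd [i] (\<lambda>x. f x * g x) = (\<lambda>x. pd [i] f x * g x + f x * pd [i] g x)"
proof
  fix x
  have "((\<lambda>x. f x * g x) has_derivative
      (\<lambda>h. f x * frechet_derivative g (at x) h + frechet_derivative f (at x) h * g x)) (at x)"
    using assms by (intro has_derivative_mult) (auto simp: frechet_derivative_works)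
  from fun_cong[OF frechet_derivative_at[OF this], of "axis i 1", symmetric]
  show "pd [i] (\<lambda>x. f x * g x) x = pd [i] f x * g x + f x * pd [i] g x"
    by simp
qed

lemma deriv_bound_mult:
  assumes "deriv_bound A r m f" "deriv_bound B r m g" "0 \<le> r"
  shows "deriv_bound (2 ^ m * A * B) r m (\<lambda>x. f x * g x)"
  using assms
proof (induction m arbitrary: A B f g)
  case 0
  then show ?case
    unfolding deriv_bound_def
    by (auto simp: norm_mult intro!: differentiable_mult mult_mono intro: order_trans[OF norm_ge_zero])
next
  case (Suc m)
  have A: "0 \<le> A" and B: "0 \<le> B" using Suc.prems by (auto dest: deriv_bound_nonneg)
  have df: "f differentiable at x" and dg: "g differentiable at x" for x
    using Suc.prems by (auto intro: deriv_bound_differentiable)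
  have step: "deriv_bound (2 ^ Suc m * A * B * r) r m (pd [i] (\<lambda>x. f x * g x))" for i
  proof -
    have "deriv_bound (2 ^ m * (A * r) * B) r m (\<lambda>x. pd [i] f x * g x)"
      using Suc.prems by (intro Suc.IH deriv_bound_pd) (auto intro: deriv_bound_mono)
    moreover have "deriv_bound (2 ^ m * A * (B * r)) r m (\<lambda>x. f x * pd [i] g x)"
      using Suc.prems by (intro Suc.IH deriv_bound_pd) (auto intro: deriv_bound_mono)
    ultimately have "deriv_bound (2 ^ m * (A * r) * B + 2 ^ m * A * (B * r)) r m
       (\<lambda>x. pd [i] f x * g x + f x * pd [i] g x)"
      by (rule deriv_bound_add)
    then show ?thesis
      unfolding pd_mult1[OF df dg] by (simp add: algebra_simps)
  qed
  show ?case
    unfolding deriv_bound_def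
  proof (intro allI impI)
    fix "is" :: "'a list" and x
    assume l: "length is \<le> Suc m"
    show "pd is (\<lambda>x. f x * g x) differentiable at x \<and>
        norm (pd is (\<lambda>x. f x * g x) x) \<le> 2 ^ Suc m * A * B * r ^ length is"
    proof (cases "is" rule: rev_cases)
      case Nil
      have "norm (f x) * norm (g x) \<le> A * B"
        using Suc.prems A by (intro mult_mono deriv_bound_norm) auto
      also have "\<dots> \<le> 2 ^ Suc m * (A * B)"
        using A B mult_right_mono[of 1 "2 ^ Suc m" "A * B"] one_le_power[of "2::real" "Suc m"] by simp
      finally show ?thesis
        using Nil df dg by (auto simp: norm_mult mult.assoc intro!: differentiable_mult)
    next
      case (snoc js i)
      then have "length js \<le> m" using l by simp
      then show ?thesis
        using step[of i] unfolding snoc pd_append deriv_bound_def by (auto simp: mult.assoc)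
    qed
  qed
qed

lemma deriv_bound_cnj:
  assumes f: "deriv_bound A r m f"
  shows "deriv_bound A r m (\<lambda>x. cnj (f x))"
proof -
  have pd_cnj: "pd is (\<lambda>x. cnj (f x)) = (\<lambda>x. cnj (pd is f x))" if "length is \<le> m" for "is"
    using that
  proof (induction "is")
    case (Cons i "is")
    have "pd is f differentiable at x" for x
      using f Cons.prems unfolding deriv_bound_def by auto
    then have "((\<lambda>x. cnj (pd is f x)) has_derivative
       (\<lambda>h. cnj (frechet_derivative (pd is f) (at x) h))) (at x)" for x
      by (intro has_derivative_cnj) (auto simp: frechet_derivative_works)
    from frechet_derivative_at[OF this]
    have "frechet_derivative (\<lambda>x. cnj (pd is f x)) (at x) = (\<lambda>h. cnj (frechet_derivative (pd is f) (at x) h))" for x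
      by simp
    then show ?case
      using Cons by simp
  qed simp
  show ?thesis
    unfolding deriv_bound_def
  proof (intro allI impI)
    fix "is" :: "'a list" and x
    assume l: "length is \<le> m"
    then have *: "pd is f differentiable at x \<and> norm (pd is f x) \<le> A * r ^ length is"
      using f unfolding deriv_bound_def by auto
    then show "pd is (\<lambda>x. cnj (f x)) differentiable at x \<and>
        norm (pd is (\<lambda>x. cnj (f x)) x) \<le> A * r ^ length is"
      unfolding pd_cnj[OF l]
      by (auto simp: differentiable_def intro: has_derivative_cnj)
  qed
qed

text \<open>Difference quotients have integral zero by translation invariance.\<close>

lemma integral_pd_eq_0:
  fixes f :: "real ^ 'n \<Rightarrow> complex"
  assumes diff: "\<And>x. f differentiable (at x)"
    and bound: "\<And>x. norm (pd [i] f x) \<le> B"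
    and supp: "\<And>x. x \<notin> cball c \<rho> \<Longrightarrow> f x = 0"
  shows "(\<integral>x. pd [i] f x \<partial>lborel) = 0"
proof -
  let ?e = "axis i 1 :: real ^ 'n"
  define \<epsilon> where "\<epsilon> n = inverse (real (Suc n))" for n
  have \<epsilon>: "\<epsilon> n > 0" "\<epsilon> n \<le> 1" for n
    by (simp_all add: \<epsilon>_def divide_simps)
  have \<epsilon>0: "\<epsilon> \<longlonglongrightarrow> 0"
    unfolding \<epsilon>_def by (rule LIMSEQ_inverse_real_of_nat)
  have cont: "continuous_on UNIV f"
    using diff by (simp add: continuous_at_imp_continuous_on differentiable_imp_continuous_within)
  then have fm[measurable]: "f \<in> borel_measurable borel"
    by (rule borel_measurable_continuous_onI)
  define D where "D n x = (f (\<epsilon> n *\<^sub>R ?e + x) - f x) /\<^sub>R \<epsilon> n" for n x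
  have fd: "(f has_derivative frechet_derivative f (at x)) (at x)" for x
    using diff by (simp add: frechet_derivative_works)
  have lim: "(\<lambda>n. D n x) \<longlonglongrightarrow> pd [i] f x" for x
  proof -
    let ?L = "frechet_derivative f (at x)"
    have "((\<lambda>h. norm (f (x + h) - f x - ?L h) / norm h) \<longlongrightarrow> 0) (at 0)"
      using fd[of x] by (simp add: has_derivative_at)
    moreover have "filterlim (\<lambda>n. \<epsilon> n *\<^sub>R ?e) (at 0) sequentially"
      unfolding filterlim_at
      using \<epsilon>(1) by (auto intro!: tendsto_eq_intros \<epsilon>0 simp: less_imp_neq[symmetric] axis_eq_0_iff)
    ultimately have "(\<lambda>n. norm (f (x + \<epsilon> n *\<^sub>R ?e) - f x - ?L (\<epsilon> n *\<^sub>R ?e)) / norm (\<epsilon> n *\<^sub>R ?e)) \<longlonglongrightarrow> 0"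
      by (rule filterlim_compose)
    moreover have "norm (f (x + \<epsilon> n *\<^sub>R ?e) - f x - ?L (\<epsilon> n *\<^sub>R ?e)) / norm (\<epsilon> n *\<^sub>R ?e)
       = norm (D n x - pd [i] f x)" for n
    proof -
      have L: "?L (\<epsilon> n *\<^sub>R ?e) = \<epsilon> n *\<^sub>R ?L ?e"
        using fd[of x] by (simp add: has_derivative_bounded_linear linear_cmul bounded_linear.linear)
      have "D n x - pd [i] f x = (f (x + \<epsilon> n *\<^sub>R ?e) - f x - ?L (\<epsilon> n *\<^sub>R ?e)) /\<^sub>R \<epsilon> n"
        using \<epsilon>(1)[of n] by (simp add: D_def L scaleR_diff_right add.commute)
      then show ?thesis
        using \<epsilon>(1)[of n] by (simp add: divide_inverse mult.commute)
    qed
    ultimately have "(\<lambda>n. norm (D n x - pd [i] f x)) \<longlonglongrightarrow> 0" by simp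
    then show ?thesis
      by (rule LIM_zero_cancel[OF tendsto_norm_zero_cancel])
  qed
  have Dle: "norm (D n x) \<le> B" for n x
  proof -
    have 1: "((\<lambda>t. f (t *\<^sub>R ?e + x)) has_derivative (\<lambda>h. frechet_derivative f (at (t *\<^sub>R ?e + x)) (h *\<^sub>R ?e))) (at t within UNIV)" for t
    proof -
      have "((\<lambda>t. t *\<^sub>R ?e + x) has_derivative (\<lambda>h. h *\<^sub>R ?e + 0)) (at t)"
        by (intro has_derivative_add has_derivative_const has_derivative_scaleR_left has_derivative_ident)
      from has_derivative_compose[OF this fd] show ?thesis by simp
    qed
    have L: "frechet_derivative f (at y) (h *\<^sub>R ?e) = h *\<^sub>R pd [i] f y" for y h
      using fd[of y] by (simp add: has_derivative_bounded_linear linear_cmul bounded_linear.linear)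
    have "norm (f (\<epsilon> n *\<^sub>R ?e + x) - f (0 *\<^sub>R ?e + x)) \<le> B * norm (\<epsilon> n - 0)"
      by (rule differentiable_bound[OF convex_UNIV 1])
        (auto simp del: pd.simps simp: L bound onorm_scaleR_left[OF bounded_linear_ident] onorm_id)
    then have "norm (f (\<epsilon> n *\<^sub>R ?e + x) - f x) \<le> B * \<epsilon> n"
      using \<epsilon>(1)[of n] by simp
    then show ?thesis
      using \<epsilon>(1)[of n] by (simp add: D_def divide_inverse[symmetric] pos_divide_le_eq flip: divide_inverse_commute)
  qed
  have Dm[measurable]: "D n \<in> borel_measurable lborel" for n
    unfolding D_def by measurable
  have "(\<lambda>n. (\<integral>x. D n x \<partial>lborel)) \<longlonglongrightarrow> (\<integral>x. pd [i] f x \<partial>lborel)"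
  proof (rule integral_dominated_convergence[where w="\<lambda>x. B * indicator (cball c (\<rho> + 1)) x"])
    show "pd [i] f \<in> borel_measurable lborel"
      by (rule borel_measurable_LIMSEQ_metric[OF Dm]) (rule lim)
    show "integrable lborel (\<lambda>x. B * indicat_real (cball c (\<rho> + 1)) x)"
      by (intro integrable_mult_right integrable_real_indicator)
         (use emeasure_lborel_cball_finite[of c "\<rho> + 1"] in auto)
    show "AE x in lborel. (\<lambda>n. D n x) \<longlonglongrightarrow> pd [i] f x"
      using lim by simp
    show "AE x in lborel. norm (D n x) \<le> B * indicator (cball c (\<rho> + 1)) x" for n
    proof (intro AE_I2)
      fix x
      show "norm (D n x) \<le> B * indicator (cball c (\<rho> + 1)) x"
      proof (cases "x \<in> cball c (\<rho> + 1)")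
        case False
        then have far: "dist c x > \<rho> + 1" by simp
        have "dist x (\<epsilon> n *\<^sub>R ?e + x) \<le> 1"
          using \<epsilon>[of n] by (simp add: dist_norm)
        then have "dist c (\<epsilon> n *\<^sub>R ?e + x) > \<rho>"
          using far dist_triangle2[of c x "\<epsilon> n *\<^sub>R ?e + x"] by (simp add: dist_commute)
        then have "f (\<epsilon> n *\<^sub>R ?e + x) = 0" "f x = 0"
          using far by (auto intro!: supp)
        then show ?thesis using False by (simp add: D_def)
      qed (use Dle in simp)
    qed
  qed measurable
  moreover have "(\<integral>x. D n x \<partial>lborel) = 0" for n
  proof -
    have fi: "integrable lborel f"
    proof -
      have "integrable lborel (\<lambda>x. indicator (cball c \<rho>) x *\<^sub>R f x)"
        using borel_integrable_compact[OF compact_cball continuous_on_subset[OF cont subset_UNIV]] .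
      also have "(\<lambda>x. indicator (cball c \<rho>) x *\<^sub>R f x) = f"
        using supp by (auto simp: fun_eq_iff indicator_def)
      finally show ?thesis .
    qed
    have d: "distr lborel borel ((+) (\<epsilon> n *\<^sub>R ?e)) = (lborel :: (real ^ 'n) measure)"
      by (rule lborel_distr_plus)
    have tr: "(\<integral>x. f (\<epsilon> n *\<^sub>R ?e + x) \<partial>lborel) = (\<integral>x. f x \<partial>lborel)"
      by (subst (2) d[symmetric], subst integral_distr) auto
    have ti: "integrable lborel (\<lambda>x. f (\<epsilon> n *\<^sub>R ?e + x))"
      using fi by (subst (asm) d[symmetric], subst (asm) integrable_distr_eq) auto
    show ?thesis
      using fi ti by (simp add: D_def tr)
  qed
  ultimately show ?thesis
    by (simp add: LIMSEQ_const_iff)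
qed

lemma pd_eq_0_outside:
  assumes "\<And>x. x \<notin> cball c \<rho> \<Longrightarrow> f x = 0" "x \<notin> cball c \<rho>"
  shows "pd [i] f x = 0"
proof -
  have "(f has_derivative (\<lambda>_. 0)) (at x)"
    by (rule has_derivative_transform_within_open[of "\<lambda>_. 0" _ x UNIV "- cball c \<rho>"])
       (use assms in auto)
  from fun_cong[OF frechet_derivative_at[OF this], of "axis i 1"] show ?thesis
    by simp
qed

lemma differentiable_borel_measurable:
  fixes f :: "real ^ 'n \<Rightarrow> complex"
  assumes "\<And>x. f differentiable (at x)"
  shows "f \<in> borel_measurable borel" "continuous_on UNIV f"
proof -
  show *: "continuous_on UNIV f"
    using assms by (simp add: continuous_at_imp_continuous_on differentiable_imp_continuous_within)
  then show "f \<in> borel_measurable borel"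
    by (rule borel_measurable_continuous_onI)
qed

lemma integrable_bounded_support:
  fixes f :: "'a::euclidean_space \<Rightarrow> complex"
  assumes [measurable]: "f \<in> borel_measurable borel"
    and "\<And>x. norm (f x) \<le> B" "\<And>x. x \<notin> cball c \<rho> \<Longrightarrow> f x = 0"
  shows "integrable lborel f"
    and "norm (\<integral>x. f x \<partial>lborel) \<le> B * measure lborel (cball c \<rho>)"
proof -
  have i: "integrable lborel (\<lambda>x. B * indicator (cball c \<rho>) x)"
    by (intro integrable_mult_right integrable_real_indicator)
      (use emeasure_lborel_cball_finite[of c \<rho>] in auto)
  have le: "norm (f x) \<le> B * indicator (cball c \<rho>) x" for x
    using assms by (auto simp: indicator_def)
  show f: "integrable lborel f"
    by (rule Bochner_Integration.integrable_bound[OF i]) (auto intro!: AE_I2 order_trans[OF le])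
  have "norm (\<integral>x. f x \<partial>lborel) \<le> (\<integral>x. norm (f x) \<partial>lborel)"
    by (rule integral_norm_bound)
  also have "\<dots> \<le> (\<integral>x. B * indicator (cball c \<rho>) x \<partial>lborel)"
    using f i by (intro integral_mono le) auto
  also have "\<dots> = B * measure lborel (cball c \<rho>)" by simp
  finally show "norm (\<integral>x. f x \<partial>lborel) \<le> B * measure lborel (cball c \<rho>)" .
qed

lemma borel_measurable_cis_inner [measurable]:
  "(\<lambda>\<xi>. cis (x \<bullet> (\<xi>::real^'n))) \<in> borel_measurable borel"
  by (intro borel_measurable_continuous_onI continuous_intros)

lemma cis_integral_pd:
  fixes g :: "real ^ 'n \<Rightarrow> complex"
  assumes g: "deriv_bound A r 1 g" and supp: "\<And>\<xi>. \<xi> \<notin> cball c \<rho> \<Longrightarrow> g \<xi> = 0"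
  shows "(\<integral>\<xi>. cis (x \<bullet> \<xi>) * pd [i] g \<xi> \<partial>lborel) = - (\<i> * (x $ i) * (\<integral>\<xi>. cis (x \<bullet> \<xi>) * g \<xi> \<partial>lborel))"
proof -
  let ?e = "\<lambda>\<xi>. cis (x \<bullet> \<xi>)"
  have gd: "g differentiable at \<xi>" for \<xi>
    using g by (rule deriv_bound_differentiable)
  have pgd: "pd [i] g differentiable at \<xi>" and pgb: "norm (pd [i] g \<xi>) \<le> A * r" for \<xi>
    using g unfolding deriv_bound_def by (auto dest!: spec[of _ "[i]"])
  have gb: "norm (g \<xi>) \<le> A" for \<xi> using g by (rule deriv_bound_norm)
  have ed: "(?e has_derivative (\<lambda>h. (x \<bullet> h) *\<^sub>R (\<i> * cis (x \<bullet> \<xi>)))) (at \<xi>)" for \<xi>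
    by (intro has_derivative_cis has_derivative_inner_right has_derivative_ident)
  have pe: "pd [i] ?e = (\<lambda>\<xi>. \<i> * (x $ i) * cis (x \<bullet> \<xi>))"
    using fun_cong[OF frechet_derivative_at[OF ed], of "axis i 1", symmetric]
    by (simp add: inner_axis scaleR_conv_of_real mult_ac)
  have ed': "?e differentiable at \<xi>" for \<xi>
    using ed unfolding differentiable_def by blast
  have prod: "pd [i] (\<lambda>\<xi>. ?e \<xi> * g \<xi>) = (\<lambda>\<xi>. \<i> * (x $ i) * (cis (x \<bullet> \<xi>) * g \<xi>) + ?e \<xi> * pd [i] g \<xi>)"
    unfolding pd_mult1[OF ed' gd] pe by (simp add: mult_ac)
  note [measurable] = differentiable_borel_measurable(1)[OF gd] differentiable_borel_measurable(1)[OF pgd]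
  have i1: "integrable lborel (\<lambda>\<xi>. ?e \<xi> * g \<xi>)"
    by (rule integrable_bounded_support[where c=c and \<rho>=\<rho> and B=A]) (use gb supp in \<open>auto simp: norm_mult\<close>)
  have i2: "integrable lborel (\<lambda>\<xi>. ?e \<xi> * pd [i] g \<xi>)"
    by (rule integrable_bounded_support[where c=c and \<rho>=\<rho> and B="A * r"])
      (use pgb pd_eq_0_outside[OF supp, where i=i] in \<open>auto simp: norm_mult simp del: pd.simps\<close>)
  have "(\<integral>\<xi>. pd [i] (\<lambda>\<xi>. ?e \<xi> * g \<xi>) \<xi> \<partial>lborel) = 0"
  proof (rule integral_pd_eq_0[where B="\<bar>x $ i\<bar> * A + A * r" and c=c and \<rho>=\<rho>])
    show "norm (pd [i] (\<lambda>\<xi>. ?e \<xi> * g \<xi>) \<xi>) \<le> \<bar>x $ i\<bar> * A + A * r" for \<xi>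
      unfolding prod
      by (rule norm_triangle_le, rule add_mono)
        (use gb pgb in \<open>auto simp: norm_mult mult_left_mono simp del: pd.simps\<close>)
  qed (use ed' gd supp in \<open>auto intro: differentiable_mult\<close>)
  then have "\<i> * (x $ i) * (\<integral>\<xi>. ?e \<xi> * g \<xi> \<partial>lborel) + (\<integral>\<xi>. ?e \<xi> * pd [i] g \<xi> \<partial>lborel) = 0"
    unfolding prod using i1 i2 by (simp del: pd.simps)
  then show ?thesis by (simp add: eq_neg_iff_add_eq_0 add.commute del: pd.simps)
qed

lemma pd_list_eq_0_outside:
  assumes "\<And>x. x \<notin> cball c \<rho> \<Longrightarrow> f x = 0" "x \<notin> cball c \<rho>"
  shows "pd is f x = 0"
  using assms(2)
proof (induction "is" arbitrary: x)
  case (Cons i "is")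
  then show ?case using pd_eq_0_outside[of c \<rho> "pd is f" x i] by simp
qed (use assms in simp)

lemma norm_cis_integral_pd_list:
  fixes h :: "real ^ 'n \<Rightarrow> complex"
  assumes h: "deriv_bound A r m h" and supp: "\<And>\<xi>. \<xi> \<notin> cball c \<rho> \<Longrightarrow> h \<xi> = 0" and "length is \<le> m"
  shows "norm (\<integral>\<xi>. cis (x \<bullet> \<xi>) * pd is h \<xi> \<partial>lborel)
     = prod_list (map (\<lambda>i. \<bar>x $ i\<bar>) is) * norm (\<integral>\<xi>. cis (x \<bullet> \<xi>) * h \<xi> \<partial>lborel)"
  using assms(3)
proof (induction "is")
  case (Cons i "is")
  have "deriv_bound (A * r ^ length is) r 1 (pd is h)"
    unfolding deriv_bound_def
  proof (intro allI impI)
    fix js :: "'n list" and \<xi>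
    assume "length js \<le> 1"
    then have "length (js @ is) \<le> m" using Cons.prems by simp
    then have "pd (js @ is) h differentiable at \<xi> \<and> norm (pd (js @ is) h \<xi>) \<le> A * r ^ length (js @ is)"
      using h unfolding deriv_bound_def by blast
    then show "pd js (pd is h) differentiable at \<xi> \<and> norm (pd js (pd is h) \<xi>) \<le> A * r ^ length is * r ^ length js"
      unfolding pd_append by (simp add: power_add mult_ac)
  qed
  from cis_integral_pd[OF this pd_list_eq_0_outside[OF supp], where x=x and i=i] Cons
  show ?case by (simp add: norm_mult mult_ac)
qed simp

lemma cis_integral_decay:
  fixes h :: "real ^ 'n \<Rightarrow> complex"
  assumes h: "deriv_bound A (1 / R) (2 * CARD('n)) h" and R: "R > 0"
    and supp: "\<And>\<xi>. \<xi> \<notin> cball c \<rho> \<Longrightarrow> h \<xi> = 0"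
  shows "norm (\<integral>\<xi>. cis (x \<bullet> \<xi>) * h \<xi> \<partial>lborel)
     \<le> A * measure lborel (cball c \<rho>) * (\<Prod>i\<in>UNIV. 2 / (1 + (R * x $ i)\<^sup>2))"
proof -
  let ?I = "norm (\<integral>\<xi>. cis (x \<bullet> \<xi>) * h \<xi> \<partial>lborel)" and ?V = "measure lborel (cball c \<rho>)"
  define S where "S = {i. R * \<bar>x $ i\<bar> \<ge> 1}"
  obtain xs where xs: "set xs = S" "distinct xs"
    using finite_distinct_list[of S] by auto
  have lxs: "length xs = card S" using xs distinct_card by fastforce
  have cS: "card S \<le> CARD('n)" by (rule card_mono) auto
  define zs where "zs = xs @ xs"
  have lz: "length zs \<le> 2 * CARD('n)" using lxs cS by (simp add: zs_def)
  have "prod_list (map (\<lambda>i. \<bar>x $ i\<bar>) zs) = (\<Prod>i\<in>S. \<bar>x $ i\<bar>) ^ 2"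
    using xs by (simp add: zs_def power2_eq_square prod.distinct_set_conv_list flip: xs(1))
  then have "(\<Prod>i\<in>S. \<bar>x $ i\<bar>) ^ 2 * ?I = norm (\<integral>\<xi>. cis (x \<bullet> \<xi>) * pd zs h \<xi> \<partial>lborel)"
    using norm_cis_integral_pd_list[OF h supp lz] by simp
  also have "\<dots> \<le> A * (1 / R) ^ length zs * ?V"
  proof (rule integrable_bounded_support(2))
    have d: "pd zs h differentiable at \<xi> \<and> norm (pd zs h \<xi>) \<le> A * (1 / R) ^ length zs" for \<xi>
      using h lz unfolding deriv_bound_def by blast
    have [measurable]: "pd zs h \<in> borel_measurable borel"
      using d by (intro differentiable_borel_measurable) auto
    show "(\<lambda>\<xi>. cis (x \<bullet> \<xi>) * pd zs h \<xi>) \<in> borel_measurable borel"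
      by measurable
    show "norm (cis (x \<bullet> \<xi>) * pd zs h \<xi>) \<le> A * (1 / R) ^ length zs" for \<xi>
      using d by (simp add: norm_mult)
    show "cis (x \<bullet> \<xi>) * pd zs h \<xi> = 0" if "\<xi> \<notin> cball c \<rho>" for \<xi>
      using pd_list_eq_0_outside[OF supp that] by simp
  qed
  also have "length zs = card S * 2" by (simp add: zs_def lxs)
  finally have "(R ^ card S * (\<Prod>i\<in>S. \<bar>x $ i\<bar>))\<^sup>2 * ?I \<le> A * ?V"
    using R by (simp add: power_mult_distrib power_divide field_simps power_mult)
  also have "R ^ card S * (\<Prod>i\<in>S. \<bar>x $ i\<bar>) = (\<Prod>i\<in>S. R * \<bar>x $ i\<bar>)"
    by (simp add: prod.distrib)
  finally have main: "(\<Prod>i\<in>S. R * \<bar>x $ i\<bar>)\<^sup>2 * ?I \<le> A * ?V" .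
  let ?P = "\<Prod>i\<in>UNIV. (1 + (R * x $ i)\<^sup>2) / 2"
  have "?P \<le> (\<Prod>i\<in>UNIV. if i \<in> S then (R * \<bar>x $ i\<bar>)\<^sup>2 else 1)"
  proof (intro prod_mono conjI)
    fix i
    show "(1 + (R * x $ i)\<^sup>2) / 2 \<le> (if i \<in> S then (R * \<bar>x $ i\<bar>)\<^sup>2 else 1)"
    proof (cases "i \<in> S")
      case True
      then have "1\<^sup>2 \<le> (R * \<bar>x $ i\<bar>)\<^sup>2" unfolding S_def by (intro power_mono) auto
      then show ?thesis using True by (simp add: power_mult_distrib)
    next
      case False
      then have "(R * \<bar>x $ i\<bar>)\<^sup>2 \<le> 1\<^sup>2" using R unfolding S_def by (intro power_mono) auto
      then show ?thesis using False by (simp add: power_mult_distrib)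
    qed
  qed (auto intro!: divide_nonneg_pos add_nonneg_nonneg)
  also have "\<dots> = (\<Prod>i\<in>S. R * \<bar>x $ i\<bar>)\<^sup>2"
    by (simp add: prod.If_cases prod_power_distrib)
  finally have "?P * ?I \<le> A * ?V"
    using main by (meson mult_right_mono norm_ge_zero order_trans)
  moreover have "?P > 0"
    by (intro prod_pos) (auto intro!: divide_pos_pos add_pos_nonneg)
  ultimately have "?I \<le> A * ?V * inverse ?P"
    by (simp add: field_simps)
  also have "inverse ?P = (\<Prod>i\<in>UNIV. 2 / (1 + (R * x $ i)\<^sup>2))"
    by (simp add: prod_inversef[symmetric])
  finally show ?thesis .
qed

lemma prod_Basis_vec:
  "(\<Prod>b\<in>(Basis :: (real ^ 'n) set). f b) = (\<Prod>i\<in>UNIV. f (axis i 1))"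
proof -
  have eq: "(Basis :: (real ^ 'n) set) = (\<lambda>i. axis i 1) ` UNIV"
    by (auto simp: Basis_vec_def)
  have "inj (\<lambda>i::'n. axis i (1::real))"
    by (simp add: inj_on_def axis_eq_axis)
  then show ?thesis
    unfolding eq by (simp add: prod.reindex)
qed

lemma nn_integral_inverse_1_plus_square_scaled:
  assumes "R > 0"
  shows "(\<integral>\<^sup>+x. ennreal (2 / (1 + (R * x)\<^sup>2)) \<partial>lborel) = ennreal (2 * pi / R)"
proof -
  have i: "integrable lborel (\<lambda>x::real. inverse (1 + x\<^sup>2))"
    using integrable_inverse_1_plus_square by (simp add: set_integrable_def)
  have v: "(\<integral>x. inverse (1 + x\<^sup>2) \<partial>lborel) = pi"
    using LBINT_inverse_1_plus_square by (simp add: interval_lebesgue_integral_def set_lebesgue_integral_def)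
  have "ennreal R * (\<integral>\<^sup>+x. ennreal (2 / (1 + (R * x)\<^sup>2)) \<partial>lborel) = (\<integral>\<^sup>+x. ennreal (2 / (1 + x\<^sup>2)) \<partial>lborel)"
    using assms by (subst (2) nn_integral_real_affine[where c=R and t=0]) auto
  also have "\<dots> = (\<integral>\<^sup>+x. ennreal (2 * inverse (1 + x\<^sup>2)) \<partial>lborel)"
    by (simp add: divide_inverse)
  also have "\<dots> = ennreal (2 * pi)"
    using i v by (subst nn_integral_eq_integral) auto
  finally have *: "ennreal R * (\<integral>\<^sup>+x. ennreal (2 / (1 + (R * x)\<^sup>2)) \<partial>lborel) = ennreal (2 * pi)" .
  have "(\<integral>\<^sup>+x. ennreal (2 / (1 + (R * x)\<^sup>2)) \<partial>lborel)
     = ennreal (1 / R) * (ennreal R * (\<integral>\<^sup>+x. ennreal (2 / (1 + (R * x)\<^sup>2)) \<partial>lborel))"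
    using assms by (simp add: mult.assoc[symmetric] flip: ennreal_mult)
  then show ?thesis
    unfolding * using assms by (simp flip: ennreal_mult)
qed

lemma nn_integral_decay_weight:
  assumes "R > 0"
  shows "(\<integral>\<^sup>+x. ennreal (\<Prod>i\<in>UNIV. 2 / (1 + (R * (x :: real ^ 'n) $ i)\<^sup>2)) \<partial>lborel) = ennreal ((2 * pi / R) ^ CARD('n))"
proof -
  have "(\<integral>\<^sup>+x. ennreal (\<Prod>i\<in>UNIV. 2 / (1 + (R * (x :: real ^ 'n) $ i)\<^sup>2)) \<partial>lborel)
    = (\<integral>\<^sup>+x. (\<Prod>b\<in>(Basis :: (real ^ 'n) set). ennreal (2 / (1 + (R * (x \<bullet> b))\<^sup>2))) \<partial>lborel)"
    unfolding prod_Basis_vec by (simp add: inner_axis prod_ennreal)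
  also have "\<dots> = (\<Prod>b\<in>(Basis :: (real ^ 'n) set). \<integral>\<^sup>+x. ennreal (2 / (1 + (R * x)\<^sup>2)) \<partial>lborel)"
    by (rule nn_integral_lborel_prod) auto
  also have "\<dots> = ennreal ((2 * pi / R) ^ CARD('n))"
    using assms unfolding nn_integral_inverse_1_plus_square_scaled[OF assms] by (simp add: ennreal_power)
  finally show ?thesis .
qed

section \<open>Fourier inversion\<close>

lemma integral_lborel_prod_vec:
  fixes f :: "'n::finite \<Rightarrow> real \<Rightarrow> complex"
  assumes "\<And>i. integrable lborel (f i)"
  shows "integrable lborel (\<lambda>x :: real ^ 'n. \<Prod>i\<in>UNIV. f i (x $ i))"
    and "(\<integral>x. (\<Prod>i\<in>UNIV. f i ((x :: real ^ 'n) $ i)) \<partial>lborel) = (\<Prod>i\<in>UNIV. \<integral>t. f i t \<partial>lborel)"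
proof -
  interpret product_sigma_finite "\<lambda>_ :: real ^ 'n. lborel :: real measure" ..
  have inj: "axis i (1::real) = axis j 1 \<longleftrightarrow> i = j" for i j :: 'n
    by (simp add: axis_eq_axis)
  define F where "F b = f (THE i. b = axis i 1)" for b :: "real ^ 'n"
  have F: "F (axis i 1) = f i" for i
    by (simp add: F_def inj)
  have [measurable]: "f i \<in> borel_measurable borel" for i
    using assms by auto
  have Fi: "integrable lborel (F b)" for b
    unfolding F_def by (rule assms)
  have eq: "(\<Prod>i\<in>UNIV. f i (x $ i)) = (\<Prod>b\<in>Basis. F b (x \<bullet> b))" for x
    unfolding prod_Basis_vec by (simp add: F inner_axis)
  have T: "(\<Prod>b\<in>Basis. F b ((\<Sum>b'\<in>Basis. y b' *\<^sub>R b') \<bullet> b)) = (\<Prod>b\<in>Basis. F b (y b))" for y :: "real ^ 'n \<Rightarrow> real"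
    by (intro prod.cong refl) simp
  have m1: "(\<lambda>f. \<Sum>b\<in>Basis. f b *\<^sub>R b) \<in> (\<Pi>\<^sub>M b\<in>(Basis :: (real ^ 'n) set). lborel) \<rightarrow>\<^sub>M borel"
    by measurable
  have m2: "(\<lambda>x. \<Prod>b\<in>Basis. F b (x \<bullet> b)) \<in> borel_measurable borel"
    using Fi by measurable
  show "integrable lborel (\<lambda>x :: real ^ 'n. \<Prod>i\<in>UNIV. f i (x $ i))"
    unfolding eq
    by (subst lborel_eq, subst integrable_distr_eq[OF m1 m2], unfold T)
      (rule product_integrable_prod[OF finite_Basis Fi])
  show "(\<integral>x. (\<Prod>i\<in>UNIV. f i ((x :: real ^ 'n) $ i)) \<partial>lborel) = (\<Prod>i\<in>UNIV. \<integral>t. f i t \<partial>lborel)"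
    unfolding eq
    by (subst lborel_eq, subst integral_distr[OF m1 m2], unfold T)
      (subst product_integral_prod[OF finite_Basis Fi], simp add: prod_Basis_vec F)
qed

lemma gauss_fourier_real:
  fixes y \<epsilon> :: real
  assumes "\<epsilon> > 0"
  shows "integrable lborel (\<lambda>x. cis (x * y) * exp (- (\<epsilon> * x)\<^sup>2 / 2))"
    and "(\<integral>x. cis (x * y) * exp (- (\<epsilon> * x)\<^sup>2 / 2) \<partial>lborel) = sqrt (2 * pi) / \<epsilon> * exp (- (y / \<epsilon>)\<^sup>2 / 2)"
proof -
  have dens: "std_normal_density x = exp (- x\<^sup>2 / 2) / sqrt (2 * pi)" for x
    by (simp add: std_normal_density_def)
  have i0: "integrable lborel (\<lambda>x. exp (- x\<^sup>2 / 2) :: real)"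
  proof -
    have "integrable lborel (\<lambda>x. sqrt (2 * pi) * std_normal_density x)"
      by (intro integrable_mult_right) (auto intro: integrable_normal_density)
    then show ?thesis by (simp add: dens)
  qed
  have i1: "integrable lborel (\<lambda>x. cis (x * t) * exp (- x\<^sup>2 / 2))" for t
    by (rule Bochner_Integration.integrable_bound[OF i0]) (auto simp: norm_mult intro!: AE_I2 borel_measurable_continuous_onI continuous_intros)
  have v1: "(\<integral>x. cis (x * t) * exp (- x\<^sup>2 / 2) \<partial>lborel) = sqrt (2 * pi) * exp (- t\<^sup>2 / 2)" for t
  proof -
    have "complex_of_real (exp (- t\<^sup>2 / 2)) = char std_normal_distribution t"
      by (simp add: char_std_normal_distribution)
    also have "\<dots> = (\<integral>x. std_normal_density x *\<^sub>R iexp (t * x) \<partial>lborel)"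
      unfolding char_def by (subst integral_density) (auto simp: normal_density_nonneg)
    also have "\<dots> = (\<integral>x. complex_of_real (1 / sqrt (2 * pi)) * (cis (x * t) * complex_of_real (exp (- x\<^sup>2 / 2))) \<partial>lborel)"
      by (intro Bochner_Integration.integral_cong)
         (auto simp: dens cis_conv_exp scaleR_conv_of_real mult_ac)
    also have "\<dots> = complex_of_real (1 / sqrt (2 * pi)) * (\<integral>x. cis (x * t) * complex_of_real (exp (- x\<^sup>2 / 2)) \<partial>lborel)"
      by simp
    finally show ?thesis by (simp add: field_simps)
  qed
  have "integrable lborel (\<lambda>x. cis ((0 + \<epsilon> * x) * (y / \<epsilon>)) * exp (- (0 + \<epsilon> * x)\<^sup>2 / 2))"
    using assms by (intro lborel_integrable_real_affine[OF i1]) auto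
  then show "integrable lborel (\<lambda>x. cis (x * y) * exp (- (\<epsilon> * x)\<^sup>2 / 2))"
    using assms by simp
  have "(\<integral>x. cis (x * (y / \<epsilon>)) * exp (- x\<^sup>2 / 2) \<partial>lborel)
     = \<bar>\<epsilon>\<bar> *\<^sub>R (\<integral>x. cis ((0 + \<epsilon> * x) * (y / \<epsilon>)) * exp (- (0 + \<epsilon> * x)\<^sup>2 / 2) \<partial>lborel)"
    using assms by (intro lborel_integral_real_affine) auto
  then show "(\<integral>x. cis (x * y) * exp (- (\<epsilon> * x)\<^sup>2 / 2) \<partial>lborel) = sqrt (2 * pi) / \<epsilon> * exp (- (y / \<epsilon>)\<^sup>2 / 2)"
    using assms unfolding v1 by (simp add: field_simps scaleR_conv_of_real)
qed

lemma cis_sum: "finite A \<Longrightarrow> cis (\<Sum>i\<in>A. f i) = (\<Prod>i\<in>A. cis (f i))"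
  by (induction A rule: finite_induct) (auto simp flip: cis_mult)

lemma norm_vec_power2: "(norm (x :: real ^ 'n))\<^sup>2 = (\<Sum>i\<in>UNIV. (x $ i)\<^sup>2)"
  unfolding power2_norm_eq_inner inner_vec_def by (simp add: power2_eq_square)

lemma gauss_fourier:
  fixes y :: "real ^ 'n" and \<epsilon> :: real
  assumes "\<epsilon> > 0"
  shows "integrable lborel (\<lambda>x. cis (x \<bullet> y) * exp (- (\<epsilon> * norm x)\<^sup>2 / 2))"
    and "(\<integral>x. cis (x \<bullet> y) * exp (- (\<epsilon> * norm x)\<^sup>2 / 2) \<partial>lborel)
       = (sqrt (2 * pi) / \<epsilon>) ^ CARD('n) * exp (- (norm y / \<epsilon>)\<^sup>2 / 2)"
proof -
  have E: "exp (- (a * norm x)\<^sup>2 / 2) = (\<Prod>i\<in>UNIV. exp (- (a * x $ i)\<^sup>2 / 2))" for x :: "real ^ 'n" and a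
    by (simp add: power_mult_distrib norm_vec_power2 flip: exp_sum)
       (simp add: sum_distrib_left sum_negf sum_divide_distrib)
  have eq: "cis (x \<bullet> y) * exp (- (\<epsilon> * norm x)\<^sup>2 / 2)
     = (\<Prod>i\<in>UNIV. cis (x $ i * y $ i) * exp (- (\<epsilon> * x $ i)\<^sup>2 / 2))" for x
    unfolding E by (simp add: inner_vec_def cis_sum prod.distrib)
  note * = integral_lborel_prod_vec[OF gauss_fourier_real(1)[OF assms], of "\<lambda>i. y $ i"]
  show "integrable lborel (\<lambda>x. cis (x \<bullet> y) * exp (- (\<epsilon> * norm x)\<^sup>2 / 2))"
    unfolding eq using *(1) by simp
  have "exp (- (norm y / \<epsilon>)\<^sup>2 / 2) = (\<Prod>i\<in>UNIV. exp (- (y $ i / \<epsilon>)\<^sup>2 / 2))"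
    using E[of "1 / \<epsilon>" y] by simp
  then show "(\<integral>x. cis (x \<bullet> y) * exp (- (\<epsilon> * norm x)\<^sup>2 / 2) \<partial>lborel)
       = (sqrt (2 * pi) / \<epsilon>) ^ CARD('n) * exp (- (norm y / \<epsilon>)\<^sup>2 / 2)"
    unfolding eq *(2) gauss_fourier_real(2)[OF assms] by (simp add: prod.distrib prod_dividef power_divide)
qed

lemma integral_lborel_affine:
  fixes f :: "'a::euclidean_space \<Rightarrow> complex"
  assumes [measurable]: "f \<in> borel_measurable borel" and "c \<noteq> 0"
  shows "(\<integral>x. f x \<partial>lborel) = complex_of_real (\<bar>c\<bar> ^ DIM('a)) * (\<integral>x. f (t + c *\<^sub>R x) \<partial>lborel)"
  by (subst lborel_affine[OF \<open>c \<noteq> 0\<close>, of t], subst integral_density)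
    (auto simp: integral_distr scaleR_conv_of_real)

lemma borel_measurable_cis_integral [measurable]:
  fixes g :: "real ^ 'n \<Rightarrow> complex"
  assumes [measurable]: "g \<in> borel_measurable borel"
  shows "(\<lambda>x. \<integral>\<xi>. cis (x \<bullet> \<xi>) * g \<xi> \<partial>lborel) \<in> borel_measurable borel"
proof -
  have "(\<lambda>z :: (real ^ 'n) \<times> (real ^ 'n). cis (fst z \<bullet> snd z)) \<in> borel_measurable borel"
    by (intro borel_measurable_continuous_onI continuous_intros)
  then have [measurable]: "(\<lambda>z :: (real ^ 'n) \<times> (real ^ 'n). cis (fst z \<bullet> snd z)) \<in> borel_measurable (borel \<Otimes>\<^sub>M borel)"
    by (simp add: borel_prod)
  show ?thesis
    by (rule lborel.borel_measurable_lebesgue_integral) (simp add: split_def)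
qed

lemma inv_fourier_measurable [measurable]:
  "g \<in> borel_measurable borel \<Longrightarrow> inv_fourier g \<in> borel_measurable borel"
  unfolding inv_fourier_def[abs_def] by measurable

lemma fourier_inv_fourier:
  fixes g :: "real ^ 'n \<Rightarrow> complex"
  assumes cont: "continuous_on UNIV g" and bdd: "\<And>\<xi>. norm (g \<xi>) \<le> B"
    and int: "integrable lborel g" and int': "integrable lborel (inv_fourier g)"
  shows "fourier (inv_fourier g) \<xi> = g \<xi>"
proof -
  define G where "G x = (\<integral>\<zeta>. cis (x \<bullet> \<zeta>) * g \<zeta> \<partial>lborel)" for x :: "real ^ 'n"
  define K where "K = sqrt (2 * pi) ^ CARD('n)"
  have K: "K > 0" by (simp add: K_def)
  have K2: "(2 * pi) powr (- real CARD('n)) = inverse (K * K)"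
  proof -
    have "K * K = (2 * pi) ^ CARD('n)"
      unfolding K_def power_mult_distrib[symmetric] by simp
    then show ?thesis by (simp add: powr_minus powr_realpow)
  qed
  have inv: "inv_fourier g x = inverse (K * K) * G x" for x
    by (simp add: inv_fourier_def G_def K2)
  have gm[measurable]: "g \<in> borel_measurable borel"
    using cont by (rule borel_measurable_continuous_onI)
  have Gm[measurable]: "G \<in> borel_measurable borel"
    unfolding G_def by measurable
  have Gi: "integrable lborel G"
  proof -
    have "integrable lborel (\<lambda>x. complex_of_real (K * K) * inv_fourier g x)"
      using int' by (intro integrable_mult_right)
    moreover have "complex_of_real (K * K) * inv_fourier g x = G x" for x
      using K by (simp add: inv field_simps)
    ultimately show ?thesis by simp
  qed
  define E where "E \<epsilon> x = exp (- (\<epsilon> * norm x)\<^sup>2 / 2)" for \<epsilon> :: real and x :: "real ^ 'n"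
  have Em[measurable]: "E \<epsilon> \<in> borel_measurable borel" for \<epsilon>
    unfolding E_def by measurable
  have E_le: "E \<epsilon> x \<le> 1" and E_nn: "0 \<le> E \<epsilon> x" for \<epsilon> x
    by (simp_all add: E_def)
  have Ei: "integrable lborel (\<lambda>x. E \<epsilon> x)" if "\<epsilon> > 0" for \<epsilon>
  proof -
    show ?thesis
      using integrable_norm[OF gauss_fourier(1)[OF that, of "0 :: real ^ 'n"]] by (simp add: E_def norm_mult)
  qed
  define I where "I \<epsilon> = (\<integral>x. cis (- (x \<bullet> \<xi>)) * E \<epsilon> x * G x \<partial>lborel)" for \<epsilon>
  have I_eq: "I \<epsilon> = K * (\<integral>z. g (\<xi> + \<epsilon> *\<^sub>R z) * E 1 z \<partial>lborel)" if \<epsilon>: "\<epsilon> > 0" for \<epsilon>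
  proof -
    let ?f = "\<lambda>x \<zeta>. cis (- (x \<bullet> \<xi>)) * E \<epsilon> x * (cis (x \<bullet> \<zeta>) * g \<zeta>)"
    have fm: "case_prod ?f \<in> borel_measurable (lborel \<Otimes>\<^sub>M lborel)"
    proof -
      have "(\<lambda>z :: (real ^ 'n) \<times> (real ^ 'n). cis (- (fst z \<bullet> \<xi>))) \<in> borel_measurable borel"
        "(\<lambda>z :: (real ^ 'n) \<times> (real ^ 'n). cis (fst z \<bullet> snd z)) \<in> borel_measurable borel"
        by (intro borel_measurable_continuous_onI continuous_intros)+
      then have [measurable]: "(\<lambda>z :: (real ^ 'n) \<times> (real ^ 'n). cis (- (fst z \<bullet> \<xi>))) \<in> borel_measurable (borel \<Otimes>\<^sub>M borel)"
        "(\<lambda>z :: (real ^ 'n) \<times> (real ^ 'n). cis (fst z \<bullet> snd z)) \<in> borel_measurable (borel \<Otimes>\<^sub>M borel)"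
        by (simp_all add: borel_prod)
      show ?thesis by (simp add: split_def)
    qed
    have Fub: "integrable (lborel \<Otimes>\<^sub>M lborel) (case_prod ?f)"
    proof (rule lborel_pair.Fubini_integrable[OF fm])
      have "integrable lborel (\<lambda>x. E \<epsilon> x * (\<integral>\<zeta>. norm (g \<zeta>) \<partial>lborel))"
        using Ei[OF \<epsilon>] by (intro integrable_mult_left)
      then show "integrable lborel (\<lambda>x. \<integral>y. norm (case (x, y) of (x, y) \<Rightarrow> ?f x y) \<partial>lborel)"
        by (simp add: norm_mult E_nn)
      have "integrable lborel (\<lambda>\<zeta>. cis (x \<bullet> \<zeta>) * g \<zeta>)" for x
        by (rule Bochner_Integration.integrable_bound[OF int]) (auto simp: norm_mult)
      then show "AE x in lborel. integrable lborel (\<lambda>y. case (x, y) of (x, y) \<Rightarrow> ?f x y)"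
        by auto
    qed
    have "I \<epsilon> = (\<integral>x. \<integral>\<zeta>. ?f x \<zeta> \<partial>lborel \<partial>lborel)"
      unfolding I_def G_def by simp
    also have "\<dots> = (\<integral>\<zeta>. \<integral>x. ?f x \<zeta> \<partial>lborel \<partial>lborel)"
      using lborel_pair.Fubini_integral[OF Fub] by simp
    also have "\<dots> = (\<integral>\<zeta>. g \<zeta> * (K / \<epsilon> ^ CARD('n) * E 1 ((\<zeta> - \<xi>) /\<^sub>R \<epsilon>)) \<partial>lborel)"
    proof (intro Bochner_Integration.integral_cong refl)
      fix \<zeta>
      have cis_eq: "cis (x \<bullet> (\<zeta> - \<xi>)) = cis (- (x \<bullet> \<xi>)) * cis (x \<bullet> \<zeta>)" for x
        by (simp add: cis_mult inner_diff_right)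
      have "(\<integral>x. ?f x \<zeta> \<partial>lborel) = (\<integral>x. g \<zeta> * (cis (x \<bullet> (\<zeta> - \<xi>)) * exp (- (\<epsilon> * norm x)\<^sup>2 / 2)) \<partial>lborel)"
        by (intro Bochner_Integration.integral_cong refl)
           (simp add: E_def cis_eq mult_ac)
      also have "\<dots> = g \<zeta> * ((sqrt (2 * pi) / \<epsilon>) ^ CARD('n) * exp (- (norm (\<zeta> - \<xi>) / \<epsilon>)\<^sup>2 / 2))"
        unfolding gauss_fourier(2)[OF \<epsilon>, symmetric] by simp
      also have "\<dots> = g \<zeta> * (K / \<epsilon> ^ CARD('n) * E 1 ((\<zeta> - \<xi>) /\<^sub>R \<epsilon>))"
      proof -
        have "norm ((\<zeta> - \<xi>) /\<^sub>R \<epsilon>) = norm (\<zeta> - \<xi>) / \<epsilon>"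
          using \<epsilon> by (simp add: divide_inverse mult.commute)
        then show ?thesis by (simp add: E_def K_def power_divide)
      qed
      finally show "(\<integral>x. ?f x \<zeta> \<partial>lborel) = g \<zeta> * (K / \<epsilon> ^ CARD('n) * E 1 ((\<zeta> - \<xi>) /\<^sub>R \<epsilon>))" .
    qed
    also have "\<dots> = \<epsilon> ^ CARD('n) * (\<integral>z. g (\<xi> + \<epsilon> *\<^sub>R z) * (K / \<epsilon> ^ CARD('n) * E 1 z) \<partial>lborel)"
      using \<epsilon> by (subst integral_lborel_affine[where c=\<epsilon> and t=\<xi>]) auto
    also have "\<dots> = \<epsilon> ^ CARD('n) * (\<integral>z. (K / \<epsilon> ^ CARD('n)) * (g (\<xi> + \<epsilon> *\<^sub>R z) * E 1 z) \<partial>lborel)"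
      by (simp add: mult_ac)
    also have "\<dots> = K * (\<integral>z. g (\<xi> + \<epsilon> *\<^sub>R z) * E 1 z \<partial>lborel)"
      using \<epsilon> by simp
    finally show ?thesis .
  qed
  define \<epsilon> where "\<epsilon> n = inverse (real (Suc n))" for n
  have \<epsilon>: "\<epsilon> n > 0" for n
    by (simp add: \<epsilon>_def)
  have \<epsilon>0: "\<epsilon> \<longlonglongrightarrow> 0"
    unfolding \<epsilon>_def by (rule LIMSEQ_inverse_real_of_nat)
  have [measurable]: "(\<lambda>x. cis (- (x \<bullet> \<xi>))) \<in> borel_measurable borel"
    by (intro borel_measurable_continuous_onI continuous_intros)
  have "(\<lambda>n. I (\<epsilon> n)) \<longlonglongrightarrow> (\<integral>x. cis (- (x \<bullet> \<xi>)) * G x \<partial>lborel)"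
    unfolding I_def
  proof (rule integral_dominated_convergence[where w="\<lambda>x. norm (G x)"])
    show "AE x in lborel. (\<lambda>n. cis (- (x \<bullet> \<xi>)) * E (\<epsilon> n) x * G x) \<longlonglongrightarrow> cis (- (x \<bullet> \<xi>)) * G x"
    proof (intro AE_I2)
      fix x
      have "(\<lambda>n. cis (- (x \<bullet> \<xi>)) * E (\<epsilon> n) x * G x) \<longlonglongrightarrow> cis (- (x \<bullet> \<xi>)) * complex_of_real (exp (- (0 * norm x)\<^sup>2 / 2)) * G x"
        unfolding E_def by (intro tendsto_intros \<epsilon>0) auto
      then show "(\<lambda>n. cis (- (x \<bullet> \<xi>)) * E (\<epsilon> n) x * G x) \<longlonglongrightarrow> cis (- (x \<bullet> \<xi>)) * G x"
        by simp
    qed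
    show "AE x in lborel. norm (cis (- (x \<bullet> \<xi>)) * E (\<epsilon> n) x * G x) \<le> norm (G x)" for n
      using E_le E_nn by (auto simp: norm_mult intro!: mult_left_le_one_le)
  qed (use Gi in auto)
  moreover have "(\<lambda>n. I (\<epsilon> n)) \<longlonglongrightarrow> K * (\<integral>z. g \<xi> * E 1 z \<partial>lborel)"
    unfolding I_eq[OF \<epsilon>]
  proof (intro tendsto_mult tendsto_const integral_dominated_convergence[where w="\<lambda>z. B * E 1 z"])
    show "AE z in lborel. (\<lambda>n. g (\<xi> + \<epsilon> n *\<^sub>R z) * E 1 z) \<longlonglongrightarrow> g \<xi> * E 1 z"
    proof (intro AE_I2 tendsto_mult tendsto_const)
      fix z
      have "(\<lambda>n. \<xi> + \<epsilon> n *\<^sub>R z) \<longlonglongrightarrow> \<xi> + 0 *\<^sub>R z"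
        by (intro tendsto_intros \<epsilon>0)
      then show "(\<lambda>n. g (\<xi> + \<epsilon> n *\<^sub>R z)) \<longlonglongrightarrow> g \<xi>"
        using cont by (auto simp: continuous_on_eq_continuous_at intro: isCont_tendsto_compose)
    qed
    show "AE z in lborel. norm (g (\<xi> + \<epsilon> n *\<^sub>R z) * E 1 z) \<le> B * E 1 z" for n
      using E_nn bdd by (auto simp: norm_mult intro!: mult_right_mono)
  qed (use Ei[of 1] in auto)
  ultimately have "(\<integral>x. cis (- (x \<bullet> \<xi>)) * G x \<partial>lborel) = K * (\<integral>z. g \<xi> * E 1 z \<partial>lborel)"
    by (rule LIMSEQ_unique)
  also have "(\<integral>z. g \<xi> * E 1 z \<partial>lborel) = g \<xi> * K"
    using gauss_fourier(2)[of 1 "0 :: real ^ 'n"] by (simp add: E_def K_def)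
  finally have "(\<integral>x. cis (- (x \<bullet> \<xi>)) * G x \<partial>lborel) = K * K * g \<xi>" by simp
  moreover have "fourier (inv_fourier g) \<xi> = (\<integral>x. inverse (K * K) * (cis (- (x \<bullet> \<xi>)) * G x) \<partial>lborel)"
    unfolding fourier_def inv by (simp add: mult_ac)
  ultimately show ?thesis
    using K by (simp add: field_simps)
qed

section \<open>Norms and the index lattice\<close>

lemma epowr_le:
  assumes "X \<le> ennreal Y" "0 \<le> Y" "0 \<le> r"
  shows "epowr X r \<le> ennreal (Y powr r)"
proof -
  have "X < top" using assms(1) ennreal_less_top le_less_trans by blast
  moreover have "enn2real X \<le> Y"
    using assms(1,2) by (simp add: enn2real_leI)
  ultimately show ?thesis
    using assms by (auto simp: epowr_def intro!: ennreal_leI powr_mono2)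
qed

lemma le_of_epowr_le:
  assumes "epowr X (1 / P) \<le> ennreal D" "0 < P" "0 \<le> D"
  shows "X \<le> ennreal (D powr P)"
proof (cases "X = \<infinity>")
  case True
  then show ?thesis using assms by (simp add: epowr_def top_unique)
next
  case False
  then have "enn2real X powr (1 / P) \<le> D"
    using assms by (simp add: epowr_def)
  then have "(enn2real X powr (1 / P)) powr P \<le> D powr P"
    using assms by (intro powr_mono2) auto
  then have "enn2real X \<le> D powr P"
    using assms by (simp add: powr_powr)
  then show ?thesis
    using False by (metis ennreal_enn2real ennreal_leI infinity_ennreal_def less_top)
qed

lemma ereal_ge_1_cases:
  assumes "1 \<le> (p :: ereal)"
  obtains "p = \<infinity>" | P where "p = ereal P" "1 \<le> P"
  using assms by (cases p) auto

lemma recip_nonneg: "1 \<le> p \<Longrightarrow> 0 \<le> recip p"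
  by (erule ereal_ge_1_cases; simp add: recip_def)

lemma Lp_norm_le_interpolation:
  assumes [measurable]: "f \<in> borel_measurable M" and p: "1 \<le> p"
    and sup: "\<And>x. norm (f x) \<le> A" and L1: "(\<integral>\<^sup>+x. ennreal (norm (f x)) \<partial>M) \<le> ennreal B"
    and B: "0 < B"
  shows "Lp_norm M p f \<le> ennreal (A powr (1 - recip p) * B powr recip p)"
proof -
  have A: "0 \<le> A" using order_trans[OF norm_ge_zero sup] by blast
  show ?thesis
    using p
  proof (cases rule: ereal_ge_1_cases)
    case 1
    have "esssup M (\<lambda>x. ennreal (norm (f x))) \<le> ennreal A"
      by (rule esssup_I) (auto intro!: AE_I2 ennreal_leI sup)
    then show ?thesis using 1 A B by (simp add: Lp_norm_def recip_def)
  next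
    case (2 P)
    have pw: "norm (f x) powr P \<le> A powr (P - 1) * norm (f x)" for x
    proof (cases "f x = 0")
      case False
      then have "norm (f x) powr P = norm (f x) powr (P - 1) * norm (f x)"
        by (simp add: powr_mult_base[symmetric] powr_diff)
      also have "\<dots> \<le> A powr (P - 1) * norm (f x)"
        using 2 sup by (intro mult_right_mono powr_mono2) auto
      finally show ?thesis .
    qed simp
    have "(\<integral>\<^sup>+x. ennreal (norm (f x) powr P) \<partial>M) \<le> (\<integral>\<^sup>+x. ennreal (A powr (P - 1)) * ennreal (norm (f x)) \<partial>M)"
      by (intro nn_integral_mono) (auto intro!: ennreal_leI pw simp flip: ennreal_mult)
    also have "\<dots> = ennreal (A powr (P - 1)) * (\<integral>\<^sup>+x. ennreal (norm (f x)) \<partial>M)"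
      by (rule nn_integral_cmult) measurable
    also have "\<dots> \<le> ennreal (A powr (P - 1)) * ennreal B"
      by (intro mult_left_mono L1) auto
    also have "\<dots> = ennreal (A powr (P - 1) * B)"
      using B by (simp add: ennreal_mult)
    finally have "epowr (\<integral>\<^sup>+x. ennreal (norm (f x) powr P) \<partial>M) (1 / P)
       \<le> ennreal ((A powr (P - 1) * B) powr (1 / P))"
      using B 2 by (intro epowr_le) auto
    also have "(A powr (P - 1) * B) powr (1 / P) = A powr (1 - 1 / P) * B powr (1 / P)"
      using A B 2 by (simp add: powr_mult powr_powr diff_divide_distrib)
    finally show ?thesis using 2 by (simp add: Lp_norm_def recip_def)
  qed
qed

lemma Lp_norm_zero: "1 \<le> p \<Longrightarrow> Lp_norm M p (\<lambda>_. 0) = 0"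
proof (erule ereal_ge_1_cases)
  assume "p = \<infinity>"
  moreover have "esssup M (\<lambda>x. 0 :: ennreal) \<le> 0"
    by (rule esssup_I) auto
  ultimately show ?thesis by (simp add: Lp_norm_def)
qed (simp add: Lp_norm_def epowr_def)

lemma mod_norm_le:
  fixes \<eta> :: "int ^ 'n \<Rightarrow> real ^ 'n \<Rightarrow> complex"
  assumes q: "1 \<le> q" and J: "finite J" "real (card J) \<le> m" "0 < m"
    and out: "\<And>j. j \<notin> J \<Longrightarrow> Lp_norm lborel p (fmult (\<eta> j) u) = 0"
    and W: "\<And>j. j \<in> J \<Longrightarrow> jbr (int_vec j) powr (s / (1 - \<alpha>)) \<le> W" "0 \<le> W"
    and B: "\<And>j. Lp_norm lborel p (fmult (\<eta> j) u) \<le> ennreal B" "0 \<le> B"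
  shows "mod_norm \<eta> \<alpha> s p q u \<le> ennreal (W * B * m powr recip q)"
  using q
proof (cases rule: ereal_ge_1_cases)
  case 1
  have "ennreal (jbr (int_vec j) powr (s / (1 - \<alpha>))) * Lp_norm lborel p (fmult (\<eta> j) u) \<le> ennreal (W * B)" for j
  proof (cases "j \<in> J")
    case True
    have "ennreal (jbr (int_vec j) powr (s / (1 - \<alpha>))) * Lp_norm lborel p (fmult (\<eta> j) u) \<le> ennreal W * ennreal B"
      using W(1)[OF True] B by (intro mult_mono ennreal_leI) auto
    then show ?thesis using W B by (simp add: ennreal_mult)
  qed (simp add: out)
  then show ?thesis
    using 1 J by (auto simp: mod_norm_def recip_def intro!: SUP_least)
next
  case (2 Q)
  let ?t = "\<lambda>j. ennreal (jbr (int_vec j) powr (s * Q / (1 - \<alpha>))) * epowr (Lp_norm lborel p (fmult (\<eta> j) u)) Q"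
  have t: "?t j \<le> ennreal ((W * B) powr Q) * indicator J j" for j
  proof (cases "j \<in> J")
    case True
    have "jbr (int_vec j) powr (s * Q / (1 - \<alpha>)) = (jbr (int_vec j) powr (s / (1 - \<alpha>))) powr Q"
      by (simp add: powr_powr)
    also have "\<dots> \<le> W powr Q"
      using W(1)[OF True] 2 by (intro powr_mono2) auto
    finally have "?t j \<le> ennreal (W powr Q) * ennreal (B powr Q)"
      using B 2 by (intro mult_mono ennreal_leI epowr_le) auto
    then show ?thesis using True W B by (simp add: ennreal_mult powr_mult)
  qed (use 2 in \<open>simp add: out epowr_def\<close>)
  have "(\<integral>\<^sup>+j. ?t j \<partial>count_space UNIV) \<le> (\<integral>\<^sup>+j. ennreal ((W * B) powr Q) * indicator J j \<partial>count_space UNIV)"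
    by (intro nn_integral_mono t)
  also have "\<dots> = ennreal ((W * B) powr Q) * of_nat (card J)"
    using J by (subst nn_integral_cmult_indicator) auto
  also have "\<dots> = ennreal ((W * B) powr Q * card J)"
    by (simp add: ennreal_mult ennreal_of_nat_eq_real_of_nat)
  also have "\<dots> \<le> ennreal ((W * B) powr Q * m)"
    using J by (intro ennreal_leI mult_left_mono) auto
  finally have "epowr (\<integral>\<^sup>+j. ?t j \<partial>count_space UNIV) (1 / Q) \<le> ennreal (((W * B) powr Q * m) powr (1 / Q))"
    using J 2 by (intro epowr_le) auto
  also have "((W * B) powr Q * m) powr (1 / Q) = W * B * m powr (1 / Q)"
    using J W B 2 by (simp add: powr_mult powr_powr)
  finally show ?thesis using 2 by (simp add: mod_norm_def recip_def)
qed

lemma jbr_ge_1: "1 \<le> jbr x"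
  by (simp add: jbr_def)

lemma norm_le_jbr: "norm x \<le> jbr x"
  unfolding jbr_def by (rule real_le_rsqrt) simp

lemma jbr_le_add: "jbr x \<le> jbr y + norm (x - y)"
proof -
  have "norm x \<le> norm y + norm (x - y)"
    using norm_triangle_sub[of x y] by simp
  then have "(norm x)\<^sup>2 \<le> (norm y + norm (x - y))\<^sup>2"
    by (intro power_mono) auto
  also have "\<dots> \<le> (norm y)\<^sup>2 + 2 * jbr y * norm (x - y) + (norm (x - y))\<^sup>2"
    using mult_right_mono[OF norm_le_jbr[of y], of "norm (x - y)"] by (simp add: power2_sum)
  finally have "1 + (norm x)\<^sup>2 \<le> (jbr y)\<^sup>2 + 2 * jbr y * norm (x - y) + (norm (x - y))\<^sup>2"
    by (simp add: jbr_def)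
  then have "1 + (norm x)\<^sup>2 \<le> (jbr y + norm (x - y))\<^sup>2"
    by (simp add: power2_sum)
  then show ?thesis
    unfolding jbr_def[of x] using jbr_ge_1[of y] by (intro real_le_lsqrt) auto
qed

lemma jbr_le_1_plus_norm: "jbr x \<le> 1 + norm x"
  using jbr_le_add[of x 0] by (simp add: jbr_def)

lemma int_vec_diff: "int_vec (j - k) = int_vec j - int_vec k"
  by (simp add: int_vec_def vec_eq_iff)

lemma card_vec_PiE:
  fixes S :: "'n::finite \<Rightarrow> 'a set"
  assumes "\<And>i. finite (S i)"
  shows "finite {x :: 'a ^ 'n. \<forall>i. x $ i \<in> S i}"
    and "card {x :: 'a ^ 'n. \<forall>i. x $ i \<in> S i} = (\<Prod>i\<in>UNIV. card (S i))"
proof -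
  have eq: "{x :: 'a ^ 'n. \<forall>i. x $ i \<in> S i} = vec_lambda ` (Pi\<^sub>E UNIV S)"
  proof (intro equalityI subsetI)
    fix x assume "x \<in> {x :: 'a ^ 'n. \<forall>i. x $ i \<in> S i}"
    then show "x \<in> vec_lambda ` (Pi\<^sub>E UNIV S)"
      by (intro image_eqI[of _ _ "vec_nth x"]) auto
  qed (auto simp: PiE_def)
  have inj: "inj_on vec_lambda (Pi\<^sub>E UNIV S)"
    by (auto simp: inj_on_def vec_lambda_inject)
  show "finite {x :: 'a ^ 'n. \<forall>i. x $ i \<in> S i}"
    unfolding eq using assms by (intro finite_imageI finite_PiE) auto
  show "card {x :: 'a ^ 'n. \<forall>i. x $ i \<in> S i} = (\<Prod>i\<in>UNIV. card (S i))"
    unfolding eq card_image[OF inj] by (simp add: card_PiE)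
qed

definition lattice_cube :: "nat \<Rightarrow> (int ^ 'n) set" where
  "lattice_cube N = {k. \<forall>i. k $ i \<in> {int N..<2 * int N}}"

lemma finite_lattice_cube: "finite (lattice_cube N)"
  unfolding lattice_cube_def by (rule card_vec_PiE) simp

lemma card_lattice_cube: "card (lattice_cube N :: (int ^ 'n) set) = N ^ CARD('n)"
  unfolding lattice_cube_def by (subst card_vec_PiE) auto

lemma lattice_cube_bounds:
  fixes k :: "int ^ 'n"
  assumes "k \<in> lattice_cube N"
  shows "real N \<le> norm (int_vec k)" "real N \<le> jbr (int_vec k)"
    "1 \<le> N \<Longrightarrow> jbr (int_vec k) \<le> (1 + 2 * real CARD('n)) * real N"
proof -
  have k: "real N \<le> int_vec k $ i" "int_vec k $ i \<le> 2 * real N" for i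
  proof -
    have "int N \<le> k $ i" "k $ i < 2 * int N"
      using assms unfolding lattice_cube_def by auto
    then have "real_of_int (int N) \<le> real_of_int (k $ i)" "real_of_int (k $ i) \<le> real_of_int (2 * int N)"
      unfolding of_int_le_iff by auto
    then show "real N \<le> int_vec k $ i" "int_vec k $ i \<le> 2 * real N"
      by (simp_all add: int_vec_def)
  qed
  have "real N \<le> \<bar>int_vec k $ i\<bar>" for i using k[of i] by simp
  then show 1: "real N \<le> norm (int_vec k)"
    using component_le_norm_cart[of "int_vec k"] order_trans by blast
  then show "real N \<le> jbr (int_vec k)"
    using norm_le_jbr order_trans by blast
  assume "1 \<le> N"
  have "norm (int_vec k) \<le> (\<Sum>i\<in>UNIV. \<bar>int_vec k $ i\<bar>)"
    by (rule norm_le_l1_cart)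
  also have "\<dots> \<le> (\<Sum>i\<in>(UNIV :: 'n set). 2 * real N)"
  proof (rule sum_mono)
    fix i show "\<bar>int_vec k $ i\<bar> \<le> 2 * real N" using k[of i] by simp
  qed
  finally show "jbr (int_vec k) \<le> (1 + 2 * real CARD('n)) * real N"
    using jbr_le_1_plus_norm[of "int_vec k"] \<open>1 \<le> N\<close> by (simp add: algebra_simps)
qed

lemma finite_int_vec_ball:
  "finite {j :: int ^ 'n. norm (int_vec j) < \<rho>}"
proof -
  have "{j :: int ^ 'n. norm (int_vec j) < \<rho>} \<subseteq> {j. \<forall>i. j $ i \<in> {- \<lceil>\<rho>\<rceil>..\<lceil>\<rho>\<rceil>}}"
  proof
    fix j :: "int ^ 'n" assume "j \<in> {j. norm (int_vec j) < \<rho>}"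
    then have "\<bar>int_vec j $ i\<bar> < \<rho>" for i
      using component_le_norm_cart[of "int_vec j" i] by simp
    then have "\<bar>real_of_int (j $ i)\<bar> < \<rho>" for i
      by (simp add: int_vec_def)
    then have "\<bar>j $ i\<bar> \<le> \<lceil>\<rho>\<rceil>" for i
    proof -
      have "real_of_int \<bar>j $ i\<bar> \<le> real_of_int \<lceil>\<rho>\<rceil>"
        unfolding of_int_abs
        using \<open>\<And>i. \<bar>real_of_int (j $ i)\<bar> < \<rho>\<close>[of i] le_of_int_ceiling[of \<rho>] by linarith
      then show ?thesis by (simp only: of_int_le_iff)
    qed
    then have "- \<lceil>\<rho>\<rceil> \<le> j $ i \<and> j $ i \<le> \<lceil>\<rho>\<rceil>" for i
      unfolding abs_le_iff using minus_le_iff by blast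
    then show "j \<in> {j. \<forall>i. j $ i \<in> {- \<lceil>\<rho>\<rceil>..\<lceil>\<rho>\<rceil>}}"
      by simp
  qed
  then show ?thesis
    using finite_subset card_vec_PiE(1)[of "\<lambda>_. {- \<lceil>\<rho>\<rceil>..\<lceil>\<rho>\<rceil>}"] by auto
qed

lemma card_int_vec_ball:
  shows "finite {j :: int ^ 'n. norm (int_vec j - int_vec k) < \<rho>}"
    and "card {j :: int ^ 'n. norm (int_vec j - int_vec k) < \<rho>} = card {j :: int ^ 'n. norm (int_vec j) < \<rho>}"
proof -
  have "bij_betw (\<lambda>j. j + k) {j :: int ^ 'n. norm (int_vec j) < \<rho>} {j. norm (int_vec j - int_vec k) < \<rho>}"
    by (rule bij_betw_byWitness[where f'="\<lambda>j. j - k"]) (auto simp flip: int_vec_diff)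
  then show "finite {j :: int ^ 'n. norm (int_vec j - int_vec k) < \<rho>}"
    "card {j :: int ^ 'n. norm (int_vec j - int_vec k) < \<rho>} = card {j :: int ^ 'n. norm (int_vec j) < \<rho>}"
    using finite_int_vec_ball[of \<rho>] bij_betw_finite bij_betw_same_card by metis+
qed

section \<open>Frequency packets\<close>

locale alpha_packets =
  fixes \<eta> :: "int ^ 'n \<Rightarrow> real ^ 'n \<Rightarrow> complex" and a c c0 C A :: real
  assumes a: "0 \<le> a" and c: "0 < c" and c0: "0 < c0" and C: "0 < C"
    and lower: "\<And>k \<xi>. dist \<xi> (jbr (int_vec k) powr a *\<^sub>R int_vec k) < c * jbr (int_vec k) powr a \<Longrightarrow> c0 \<le> norm (\<eta> k \<xi>)"
    and supp: "\<And>k \<xi>. \<eta> k \<xi> \<noteq> 0 \<Longrightarrow> dist \<xi> (jbr (int_vec k) powr a *\<^sub>R int_vec k) < C * jbr (int_vec k) powr a"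
    and derivs: "\<And>k \<gamma> \<xi>. length \<gamma> \<le> 2 * CARD('n) \<Longrightarrow> pd \<gamma> (\<eta> k) differentiable (at \<xi>) \<and>
       norm (pd \<gamma> (\<eta> k) \<xi>) \<le> A * jbr (int_vec k) powr (- a * real (length \<gamma>))"
begin

definition ctr :: "int ^ 'n \<Rightarrow> real ^ 'n" where
  "ctr k = jbr (int_vec k) powr a *\<^sub>R int_vec k"

definition packet :: "int ^ 'n \<Rightarrow> real ^ 'n \<Rightarrow> complex" where
  "packet k \<xi> = \<eta> k \<xi> * cnj (\<eta> k \<xi>)"

definition scale :: "nat \<Rightarrow> real" where
  "scale N = real N powr a"

lemma scale_pos: "1 \<le> N \<Longrightarrow> 0 < scale N"
  by (simp add: scale_def)

lemma A_nonneg: "0 \<le> A"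
proof -
  have "jbr (int_vec (0 :: int ^ 'n)) \<noteq> 0"
    using jbr_ge_1[of "int_vec (0 :: int ^ 'n)"] by linarith
  then have "norm (\<eta> 0 0) \<le> A"
    using derivs[of "[]" 0 0] by simp
  then show ?thesis
    using norm_ge_zero order_trans by blast
qed

text \<open>The map from indices to centres is strongly monotone, hence only neighbouring supports meet.\<close>

lemma overlap_near:
  assumes "\<eta> j \<xi> \<noteq> 0" "\<eta> k \<xi> \<noteq> 0"
  shows "norm (int_vec j - int_vec k) < 2 * C"
proof -
  define x y where "x = int_vec j" and "y = int_vec k"
  define u v where "u = jbr x powr a" and "v = jbr y powr a"
  have uv: "0 < u" "0 < v" using jbr_ge_1[of x] jbr_ge_1[of y] by (auto simp: u_def v_def)
  have mono: "0 \<le> (u - v) * ((norm x)\<^sup>2 - (norm y)\<^sup>2)"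
  proof (cases "norm x \<le> norm y")
    case True
    then have "(norm x)\<^sup>2 \<le> (norm y)\<^sup>2" by (intro power_mono) auto
    moreover from this have "u \<le> v"
      unfolding u_def v_def using a jbr_ge_1[of x] by (intro powr_mono2) (auto simp: jbr_def)
    ultimately show ?thesis by (intro mult_nonpos_nonpos) auto
  next
    case False
    then have "(norm y)\<^sup>2 \<le> (norm x)\<^sup>2" by (intro power_mono) auto
    moreover from this have "v \<le> u"
      unfolding u_def v_def using a jbr_ge_1[of y] by (intro powr_mono2) (auto simp: jbr_def)
    ultimately show ?thesis by (intro mult_nonneg_nonneg) auto
  qed
  have "(u + v) / 2 * (norm (x - y))\<^sup>2 + (u - v) * ((norm x)\<^sup>2 - (norm y)\<^sup>2) / 2
     = (u *\<^sub>R x - v *\<^sub>R y) \<bullet> (x - y)"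
    by (simp add: power2_norm_eq_inner inner_diff_left inner_diff_right inner_commute[of y x] field_simps)
  with mono have "(u + v) / 2 * (norm (x - y))\<^sup>2 \<le> (u *\<^sub>R x - v *\<^sub>R y) \<bullet> (x - y)"
    by linarith
  also have "\<dots> \<le> norm (u *\<^sub>R x - v *\<^sub>R y) * norm (x - y)"
    by (rule norm_cauchy_schwarz)
  finally have *: "(u + v) / 2 * norm (x - y) * norm (x - y) \<le> norm (u *\<^sub>R x - v *\<^sub>R y) * norm (x - y)"
    by (simp add: power2_eq_square mult.assoc)
  have "dist (u *\<^sub>R x) (v *\<^sub>R y) < C * u + C * v"
    using supp[OF assms(1)] supp[OF assms(2)] dist_triangle2[of "u *\<^sub>R x" "v *\<^sub>R y" \<xi>]
    by (simp add: x_def y_def u_def v_def dist_commute)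
  then have d: "norm (u *\<^sub>R x - v *\<^sub>R y) < C * (u + v)"
    by (simp add: dist_norm distrib_left)
  show ?thesis
  proof (cases "x = y")
    case True then show ?thesis using C by (simp add: x_def y_def)
  next
    case False
    then have "(u + v) / 2 * norm (x - y) \<le> norm (u *\<^sub>R x - v *\<^sub>R y)"
      using * by simp
    then have "(u + v) * norm (x - y) < (u + v) * (2 * C)"
      using d by (simp add: algebra_simps)
    then have "norm (x - y) < 2 * C" using uv by simp
    then show ?thesis by (simp add: x_def y_def)
  qed
qed

definition near :: "int ^ 'n \<Rightarrow> (int ^ 'n) set" where
  "near k = {j. norm (int_vec j - int_vec k) < 2 * C}"

definition nnear :: nat where
  "nnear = card {j :: int ^ 'n. norm (int_vec j) < 2 * C}"

lemma near_sym: "j \<in> near k \<longleftrightarrow> k \<in> near j"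
  by (simp add: near_def norm_minus_commute)

lemma near_refl: "k \<in> near k"
  using C by (simp add: near_def)

lemma finite_near: "finite (near k)" and card_near: "card (near k) = nnear"
  unfolding near_def nnear_def by (rule card_int_vec_ball)+

lemma nnear_pos: "0 < nnear"
  using card_near[of 0] near_refl[of 0] finite_near[of 0] card_gt_0_iff by fastforce

lemma mult_packet_eq_0: "j \<notin> near k \<Longrightarrow> \<eta> j \<xi> * packet k \<xi> = 0"
  using overlap_near[of j \<xi> k] by (auto simp: packet_def near_def)

lemma jbr_near:
  assumes "j \<in> near k"
  shows "jbr (int_vec j) \<le> (1 + 2 * C) * jbr (int_vec k)"
proof -
  have "jbr (int_vec j) \<le> jbr (int_vec k) + 2 * C"
    using jbr_le_add[of "int_vec j" "int_vec k"] assms by (simp add: near_def)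
  also have "\<dots> \<le> jbr (int_vec k) + 2 * C * jbr (int_vec k)"
    using C jbr_ge_1[of "int_vec k"] mult_left_mono[of 1 "jbr (int_vec k)" "2 * C"] by simp
  finally show ?thesis by (simp add: algebra_simps)
qed

lemma jbr_near_cube:
  assumes "j \<in> near k" "k \<in> lattice_cube N" "1 \<le> N"
  shows "real N / (1 + 2 * C) \<le> jbr (int_vec j)"
    and "jbr (int_vec j) \<le> (1 + 2 * C) * (1 + 2 * real CARD('n)) * real N"
proof -
  have "real N \<le> (1 + 2 * C) * jbr (int_vec j)"
    using lattice_cube_bounds(2)[OF assms(2)] jbr_near[of k j] assms(1) near_sym by fastforce
  then show "real N / (1 + 2 * C) \<le> jbr (int_vec j)"
    using C by (simp add: pos_divide_le_eq mult.commute)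
  have "jbr (int_vec j) \<le> (1 + 2 * C) * jbr (int_vec k)"
    using assms(1) by (rule jbr_near)
  also have "\<dots> \<le> (1 + 2 * C) * ((1 + 2 * real CARD('n)) * real N)"
    using C lattice_cube_bounds(3)[OF assms(2,3)] by (intro mult_left_mono) auto
  finally show "jbr (int_vec j) \<le> (1 + 2 * C) * (1 + 2 * real CARD('n)) * real N"
    by (simp add: mult.assoc)
qed

definition A1 :: real where
  "A1 = A * (1 + 2 * C) powr (a * real (2 * CARD('n)))"

lemma deriv_bound_near:
  assumes "j \<in> near k" "k \<in> lattice_cube N" "1 \<le> N"
  shows "deriv_bound A1 (1 / scale N) (2 * CARD('n)) (\<eta> j)"
  unfolding deriv_bound_def
proof (intro allI impI)
  fix \<gamma> :: "'n list" and \<xi>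
  assume l: "length \<gamma> \<le> 2 * CARD('n)"
  let ?l = "real (length \<gamma>)"
  have "jbr (int_vec j) powr (- a * ?l) \<le> (real N / (1 + 2 * C)) powr (- a * ?l)"
    using jbr_near_cube(1)[OF assms] C \<open>1 \<le> N\<close> a by (intro powr_mono2') auto
  also have "\<dots> = (1 + 2 * C) powr (a * ?l) * (1 / scale N) ^ length \<gamma>"
    using C \<open>1 \<le> N\<close>
    by (simp add: powr_divide powr_minus scale_def power_divide powr_powr field_simps flip: powr_realpow)
  also have "\<dots> \<le> (1 + 2 * C) powr (a * real (2 * CARD('n))) * (1 / scale N) ^ length \<gamma>"
    using C a l scale_pos[OF \<open>1 \<le> N\<close>] by (intro mult_right_mono powr_mono mult_left_mono) auto
  finally have "A * jbr (int_vec j) powr (- a * ?l) \<le> A1 * (1 / scale N) ^ length \<gamma>"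
    using A_nonneg unfolding A1_def by (simp only: mult.assoc mult_left_mono)
  then show "pd \<gamma> (\<eta> j) differentiable at \<xi> \<and> norm (pd \<gamma> (\<eta> j) \<xi>) \<le> A1 * (1 / scale N) ^ length \<gamma>"
    using derivs[OF l, of j \<xi>] by auto
qed

definition A2 :: real where "A2 = 2 ^ (2 * CARD('n)) * A1 * A1"
definition A3 :: real where "A3 = 2 ^ (2 * CARD('n)) * A1 * A2"

lemma deriv_bound_packet:
  assumes "k \<in> lattice_cube N" "1 \<le> N"
  shows "deriv_bound A2 (1 / scale N) (2 * CARD('n)) (packet k)"
  unfolding packet_def A2_def using scale_pos[OF assms(2)] assms
  by (intro deriv_bound_mult deriv_bound_cnj deriv_bound_near[OF near_refl]) auto

lemma deriv_bound_mult_packet: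
  assumes "j \<in> near k" "k \<in> lattice_cube N" "1 \<le> N"
  shows "deriv_bound A3 (1 / scale N) (2 * CARD('n)) (\<lambda>\<xi>. \<eta> j \<xi> * packet k \<xi>)"
  unfolding A3_def using scale_pos[OF assms(3)] assms
  by (intro deriv_bound_mult deriv_bound_near deriv_bound_packet) auto

definition C2 :: real where "C2 = C * (1 + 2 * real CARD('n)) powr a"

lemma C2: "0 < C2" using C by (simp add: C2_def add_pos_nonneg)

lemma packet_supp:
  assumes "k \<in> lattice_cube N" "1 \<le> N" "\<xi> \<notin> cball (ctr k) (C2 * scale N)"
  shows "packet k \<xi> = 0"
proof (rule ccontr)
  assume "packet k \<xi> \<noteq> 0"
  then have "dist \<xi> (ctr k) < C * jbr (int_vec k) powr a"
    using supp[of k \<xi>] by (auto simp: packet_def ctr_def)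
  also have "\<dots> \<le> C * ((1 + 2 * real CARD('n)) * real N) powr a"
    using a C jbr_ge_1[of "int_vec k"] lattice_cube_bounds(3)[OF assms(1,2)]
    by (intro mult_left_mono powr_mono2) auto
  also have "\<dots> = C2 * scale N"
    by (simp add: C2_def scale_def powr_mult)
  finally show False using assms(3) by (simp add: dist_commute)
qed

definition weight :: "nat \<Rightarrow> real ^ 'n \<Rightarrow> real" where
  "weight N x = (\<Prod>i\<in>UNIV. 2 / (1 + (scale N * x $ i)\<^sup>2))"

lemma weight_nonneg: "0 \<le> weight N x"
  unfolding weight_def by (intro prod_nonneg) (auto intro!: divide_nonneg_nonneg add_nonneg_nonneg)

lemma weight_le: "weight N x \<le> 2 ^ CARD('n)"
proof -
  have "weight N x \<le> (\<Prod>i\<in>(UNIV :: 'n set). 2)"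
    unfolding weight_def
    by (intro prod_mono) (auto simp: divide_simps add_pos_nonneg intro!: add_nonneg_nonneg)
  then show ?thesis by simp
qed

lemma weight_measurable [measurable]: "weight N \<in> borel_measurable borel"
  unfolding weight_def by measurable

lemma nn_integral_weight_shift:
  assumes "1 \<le> N"
  shows "(\<integral>\<^sup>+x. ennreal (weight N (x - y)) \<partial>lborel) = ennreal ((2 * pi / scale N) ^ CARD('n))"
proof -
  have "(\<integral>\<^sup>+x. ennreal (weight N (x - y)) \<partial>lborel)
     = (\<integral>\<^sup>+x. ennreal (weight N (x - y)) \<partial>distr lborel borel ((+) y))"
    by (simp add: lborel_distr_plus)
  also have "\<dots> = (\<integral>\<^sup>+x. ennreal (weight N x) \<partial>lborel)"
    by (subst nn_integral_distr) auto
  also have "\<dots> = ennreal ((2 * pi / scale N) ^ CARD('n))"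
    unfolding weight_def by (rule nn_integral_decay_weight[OF scale_pos[OF assms]])
  finally show ?thesis .
qed

definition B1 :: real where
  "B1 = (A2 + A3) * unit_ball_vol (real CARD('n)) * C2 ^ CARD('n)"

lemma inv_fourier_const_le: "(2 * pi) powr (- real CARD('n)) \<le> 1"
  using pi_ge_two by (simp add: powr_minus inverse_le_1_iff ge_one_powr_ge_zero)

lemma A123_nonneg: "0 \<le> A1" "0 \<le> A2" "0 \<le> A3"
  using A_nonneg by (auto simp: A1_def A2_def A3_def)

lemma B1_nonneg: "0 \<le> B1"
  using A123_nonneg C2 by (simp add: B1_def unit_ball_vol_nonneg)

lemma inv_fourier_decay:
  assumes k: "k \<in> lattice_cube N" and N: "1 \<le> N"
    and h: "deriv_bound A' (1 / scale N) (2 * CARD('n)) h" "A' \<le> A2 + A3"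
      "\<And>\<xi>. packet k \<xi> = 0 \<Longrightarrow> h \<xi> = 0"
  shows "norm (inv_fourier h x) \<le> B1 * scale N ^ CARD('n) * weight N x"
proof -
  have V: "measure lborel (cball (ctr k) (C2 * scale N))
     = unit_ball_vol (real CARD('n)) * (C2 * scale N) ^ CARD('n)"
    using content_cball[of "C2 * scale N" "ctr k"] C2 scale_pos[OF N] by simp
  have "norm (inv_fourier h x) \<le> norm (\<integral>\<xi>. cis (x \<bullet> \<xi>) * h \<xi> \<partial>lborel)"
    unfolding inv_fourier_def norm_mult using inv_fourier_const_le by (intro mult_left_le_one_le) auto
  also have "\<dots> \<le> A' * measure lborel (cball (ctr k) (C2 * scale N)) * weight N x"
    unfolding weight_def
    by (rule cis_integral_decay[OF h(1) scale_pos[OF N]]) (use h(3) packet_supp[OF k N] in auto)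
  also have "\<dots> \<le> (A2 + A3) * measure lborel (cball (ctr k) (C2 * scale N)) * weight N x"
    using h(2) weight_nonneg by (intro mult_right_mono) auto
  also have "\<dots> = B1 * scale N ^ CARD('n) * weight N x"
    by (simp add: V B1_def power_mult_distrib)
  finally show ?thesis .
qed

lemma inv_fourier_packet:
  assumes "k \<in> lattice_cube N" "1 \<le> N"
  shows "norm (inv_fourier (packet k) x) \<le> B1 * scale N ^ CARD('n) * weight N x"
  by (rule inv_fourier_decay[OF assms deriv_bound_packet[OF assms]]) (use A123_nonneg in auto)

lemma inv_fourier_mult_packet:
  assumes "k \<in> lattice_cube N" "1 \<le> N"
  shows "norm (inv_fourier (\<lambda>\<xi>. \<eta> j \<xi> * packet k \<xi>) x) \<le> B1 * scale N ^ CARD('n) * weight N x"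
proof (cases "j \<in> near k")
  case True
  show ?thesis
    by (rule inv_fourier_decay[OF assms deriv_bound_mult_packet[OF True assms]]) (use A123_nonneg in auto)
next
  case False
  then show ?thesis
    using B1_nonneg weight_nonneg[of N x] scale_pos[OF assms(2)]
    by (simp add: mult_packet_eq_0 inv_fourier_def)
qed


lemma packet_continuous: "continuous_on UNIV (packet k)" and packet_measurable [measurable]: "packet k \<in> borel_measurable borel"
  and \<eta>_measurable [measurable]: "\<eta> k \<in> borel_measurable borel"
proof -
  have d: "\<eta> k differentiable at \<xi>" for \<xi> using derivs[of "[]" k \<xi>] by simp
  from differentiable_borel_measurable[OF d]
  show "continuous_on UNIV (packet k)" "packet k \<in> borel_measurable borel" "\<eta> k \<in> borel_measurable borel"
    unfolding packet_def[abs_def]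
    by (auto intro!: continuous_intros borel_measurable_continuous_onI)
qed

lemma \<eta>_bounded: "norm (\<eta> k \<xi>) \<le> A"
  using derivs[of "[]" k \<xi>] jbr_ge_1[of "int_vec k"] by (simp split: if_splits)

lemma packet_bounded: "norm (packet k \<xi>) \<le> A * A"
  unfolding packet_def norm_mult complex_mod_cnj using \<eta>_bounded A_nonneg by (intro mult_mono) auto

lemma integrable_mult_packet:
  assumes [measurable]: "m \<in> borel_measurable borel" and m: "\<And>\<xi>. norm (m \<xi>) \<le> M"
    and k: "k \<in> lattice_cube N" "1 \<le> N"
  shows "integrable lborel (\<lambda>\<xi>. m \<xi> * packet k \<xi>)"
proof (rule integrable_bounded_support)
  show "norm (m \<xi> * packet k \<xi>) \<le> M * (A * A)" for \<xi>
    unfolding norm_mult using m packet_bounded order_trans[OF norm_ge_zero m] by (intro mult_mono) auto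
  show "m \<xi> * packet k \<xi> = 0" if "\<xi> \<notin> cball (ctr k) (C2 * scale N)" for \<xi>
    using packet_supp[OF k that] by simp
qed measurable

definition superpos :: "(int ^ 'n) set \<Rightarrow> (int ^ 'n \<Rightarrow> real) \<Rightarrow> (int ^ 'n \<Rightarrow> real ^ 'n) \<Rightarrow> real ^ 'n \<Rightarrow> complex" where
  "superpos K e y \<xi> = (\<Sum>k\<in>K. complex_of_real (e k) * (cis (- (y k \<bullet> \<xi>)) * packet k \<xi>))"

lemma inv_fourier_mult_superpos:
  assumes [measurable]: "m \<in> borel_measurable borel" and m: "\<And>\<xi>. norm (m \<xi>) \<le> M"
    and K: "K \<subseteq> lattice_cube N" "1 \<le> N"
  shows "inv_fourier (\<lambda>\<xi>. m \<xi> * superpos K e y \<xi>) x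
     = (\<Sum>k\<in>K. complex_of_real (e k) * inv_fourier (\<lambda>\<xi>. m \<xi> * packet k \<xi>) (x - y k))"
proof -
  have i: "integrable lborel (\<lambda>\<xi>. cis ((x - y k) \<bullet> \<xi>) * (m \<xi> * packet k \<xi>))" if "k \<in> K" for k
  proof -
    have "integrable lborel (\<lambda>\<xi>. (cis ((x - y k) \<bullet> \<xi>) * m \<xi>) * packet k \<xi>)"
      using that K m by (intro integrable_mult_packet[where M=M and N=N]) (auto simp: norm_mult)
    then show ?thesis by (simp add: mult.assoc)
  qed
  have "cis (x \<bullet> \<xi>) * (m \<xi> * superpos K e y \<xi>)
     = (\<Sum>k\<in>K. complex_of_real (e k) * (cis ((x - y k) \<bullet> \<xi>) * (m \<xi> * packet k \<xi>)))" for \<xi>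
    unfolding superpos_def sum_distrib_left
  proof (rule sum.cong[OF refl])
    fix k
    have "cis ((x - y k) \<bullet> \<xi>) = cis (x \<bullet> \<xi>) * cis (- (y k \<bullet> \<xi>))"
      by (simp add: cis_mult inner_diff_left)
    then show "cis (x \<bullet> \<xi>) * (m \<xi> * (complex_of_real (e k) * (cis (- (y k \<bullet> \<xi>)) * packet k \<xi>)))
       = complex_of_real (e k) * (cis ((x - y k) \<bullet> \<xi>) * (m \<xi> * packet k \<xi>))"
      by (simp add: mult_ac)
  qed
  then have "(\<integral>\<xi>. cis (x \<bullet> \<xi>) * (m \<xi> * superpos K e y \<xi>) \<partial>lborel)
    = (\<Sum>k\<in>K. complex_of_real (e k) * (\<integral>\<xi>. cis ((x - y k) \<bullet> \<xi>) * (m \<xi> * packet k \<xi>) \<partial>lborel))"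
    using i by (simp add: Bochner_Integration.integral_sum)
  then show ?thesis
    by (simp add: inv_fourier_def sum_distrib_left mult_ac)
qed

lemma superpos_continuous: "continuous_on UNIV (superpos K e y)"
  unfolding superpos_def[abs_def] by (intro continuous_intros packet_continuous)

lemma superpos_bounded:
  assumes "\<And>k. \<bar>e k\<bar> \<le> 1"
  shows "norm (superpos K e y \<xi>) \<le> real (card K) * (A * A)"
proof -
  have "norm (superpos K e y \<xi>) \<le> (\<Sum>k\<in>K. A * A)"
    unfolding superpos_def
  proof (rule sum_norm_le)
    fix k
    have "\<bar>e k\<bar> * norm (packet k \<xi>) \<le> 1 * (A * A)"
      using assms packet_bounded A_nonneg by (intro mult_mono) auto
    then show "norm (complex_of_real (e k) * (cis (- (y k \<bullet> \<xi>)) * packet k \<xi>)) \<le> A * A"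
      by (simp add: norm_mult)
  qed
  then show ?thesis by simp
qed

lemma superpos_integrable:
  assumes K: "K \<subseteq> lattice_cube N" "1 \<le> N"
  shows "integrable lborel (superpos K e y)"
proof -
  have "integrable lborel (\<lambda>\<xi>. cis (- (y k \<bullet> \<xi>)) * packet k \<xi>)" if "k \<in> K" for k
    using that K
    by (intro integrable_mult_packet[where M=1 and N=N])
       (auto intro!: borel_measurable_continuous_onI continuous_intros)
  then show ?thesis
    unfolding superpos_def[abs_def] by (intro Bochner_Integration.integrable_sum integrable_mult_right) auto
qed

lemma integrable_inv_fourier_superpos:
  assumes K: "K \<subseteq> lattice_cube N" "1 \<le> N"
  shows "integrable lborel (inv_fourier (superpos K e y))"
proof -
  have p: "integrable lborel (\<lambda>x. inv_fourier (packet k) (x - y k))" if "k \<in> K" for k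
  proof (rule integrableI_bounded)
    have "(\<integral>\<^sup>+x. ennreal (norm (inv_fourier (packet k) (x - y k))) \<partial>lborel)
      \<le> (\<integral>\<^sup>+x. ennreal (B1 * scale N ^ CARD('n)) * ennreal (weight N (x - y k)) \<partial>lborel)"
      using that K B1_nonneg scale_pos[OF K(2)] weight_nonneg
      by (intro nn_integral_mono) (auto simp flip: ennreal_mult intro!: ennreal_leI inv_fourier_packet)
    also have "\<dots> = ennreal (B1 * scale N ^ CARD('n)) * ennreal ((2 * pi / scale N) ^ CARD('n))"
      by (subst nn_integral_cmult) (auto simp: nn_integral_weight_shift[OF K(2)])
    also have "\<dots> < \<infinity>" by (simp add: ennreal_mult_less_top)
    finally show "(\<integral>\<^sup>+x. ennreal (norm (inv_fourier (packet k) (x - y k))) \<partial>lborel) < \<infinity>" .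
  qed measurable
  have "inv_fourier (superpos K e y) = (\<lambda>x. \<Sum>k\<in>K. complex_of_real (e k) * inv_fourier (packet k) (x - y k))"
    using inv_fourier_mult_superpos[where m="\<lambda>_. 1" and M=1, OF _ _ K] by auto
  then show ?thesis
    using p by (auto intro!: Bochner_Integration.integrable_sum integrable_mult_right)
qed

lemma fourier_superpos:
  assumes K: "K \<subseteq> lattice_cube N" "1 \<le> N" and e: "\<And>k. \<bar>e k\<bar> \<le> 1"
  shows "fourier (inv_fourier (superpos K e y)) = superpos K e y"
  by (rule ext, rule fourier_inv_fourier[OF superpos_continuous superpos_bounded superpos_integrable[OF K]
      integrable_inv_fourier_superpos[OF K]], rule e)

definition B2 :: "ereal \<Rightarrow> real" where
  "B2 p = (real nnear * B1 * 2 ^ CARD('n) + 1) powr (1 - recip p) * (real nnear * B1 * (2 * pi) ^ CARD('n) + 1) powr recip p"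

lemma frequency_block_superpos:
  fixes y
  assumes K: "K \<subseteq> lattice_cube N" "1 \<le> N" and e: "\<And>k. \<bar>e k\<bar> \<le> 1" and p: "1 \<le> p"
  defines "u \<equiv> inv_fourier (superpos K e y)"
  shows "Lp_norm lborel p (fmult (\<eta> j) u) \<le> ennreal (B2 p * real N powr (a * real CARD('n) * (1 - recip p)))"
    and "(\<And>k. k \<in> K \<Longrightarrow> j \<notin> near k) \<Longrightarrow> Lp_norm lborel p (fmult (\<eta> j) u) = 0"
proof -
  let ?n = "CARD('n)"
  have fin: "finite K" using K(1) finite_lattice_cube finite_subset by blast
  define H where "H k = inv_fourier (\<lambda>\<xi>. \<eta> j \<xi> * packet k \<xi>)" for k
  have Hm[measurable]: "H k \<in> borel_measurable borel" for k unfolding H_def by measurable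
  have H0: "H k x = 0" if "j \<notin> near k" for k x
    using that by (simp add: H_def mult_packet_eq_0 inv_fourier_def)
  have Hle: "norm (H k x) \<le> B1 * scale N ^ ?n * weight N x" if "k \<in> K" for k x
    unfolding H_def using that K by (intro inv_fourier_mult_packet) auto
  have eq: "fmult (\<eta> j) u = (\<lambda>x. \<Sum>k\<in>K. complex_of_real (e k) * H k (x - y k))"
    unfolding fmult_def u_def fourier_superpos[OF K e] H_def
    by (rule ext, rule inv_fourier_mult_superpos[OF \<eta>_measurable \<eta>_bounded K])
  show "Lp_norm lborel p (fmult (\<eta> j) u) = 0" if "\<And>k. k \<in> K \<Longrightarrow> j \<notin> near k"
    unfolding eq using Lp_norm_zero[OF p] that by (simp add: H0)
  define K' where "K' = K \<inter> near j"
  have cK': "real (card K') \<le> real nnear"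
    unfolding card_near[of j, symmetric] of_nat_le_iff K'_def by (intro card_mono finite_near) auto
  have eq': "fmult (\<eta> j) u x = (\<Sum>k\<in>K'. complex_of_real (e k) * H k (x - y k))" for x
    unfolding eq K'_def by (rule sum.mono_neutral_right) (use fin H0 near_sym in auto)
  have pw: "norm (fmult (\<eta> j) u x) \<le> (\<Sum>k\<in>K'. B1 * scale N ^ ?n * weight N (x - y k))" for x
    unfolding eq'
  proof (rule sum_norm_le)
    fix k assume "k \<in> K'"
    then have "\<bar>e k\<bar> * norm (H k (x - y k)) \<le> 1 * (B1 * scale N ^ ?n * weight N (x - y k))"
      using e by (intro mult_mono Hle) (auto simp: K'_def)
    then show "norm (complex_of_real (e k) * H k (x - y k)) \<le> B1 * scale N ^ ?n * weight N (x - y k)"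
      by (simp add: norm_mult)
  qed
  have s: "0 < scale N" using K(2) by (rule scale_pos)
  have sup: "norm (fmult (\<eta> j) u x) \<le> (real nnear * B1 * 2 ^ ?n + 1) * scale N ^ ?n" for x
  proof -
    have "norm (fmult (\<eta> j) u x) \<le> (\<Sum>k\<in>K'. B1 * scale N ^ ?n * 2 ^ ?n)"
      using pw[of x] by (rule order_trans) (use B1_nonneg s in \<open>intro sum_mono mult_left_mono weight_le; simp\<close>)
    also have "\<dots> \<le> real nnear * (B1 * scale N ^ ?n * 2 ^ ?n)"
      using B1_nonneg s cK' by (simp add: mult_right_mono)
    also have "\<dots> \<le> (real nnear * B1 * 2 ^ ?n + 1) * scale N ^ ?n"
      using s by (simp add: algebra_simps)
    finally show ?thesis .
  qed
  have L1: "(\<integral>\<^sup>+x. ennreal (norm (fmult (\<eta> j) u x)) \<partial>lborel) \<le> ennreal (real nnear * B1 * (2 * pi) ^ ?n + 1)"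
  proof -
    have "(\<integral>\<^sup>+x. ennreal (norm (fmult (\<eta> j) u x)) \<partial>lborel)
       \<le> (\<integral>\<^sup>+x. (\<Sum>k\<in>K'. ennreal (B1 * scale N ^ ?n) * ennreal (weight N (x - y k))) \<partial>lborel)"
    proof (rule nn_integral_mono)
      fix x
      have "(\<Sum>k\<in>K'. ennreal (B1 * scale N ^ ?n) * ennreal (weight N (x - y k)))
         = ennreal (\<Sum>k\<in>K'. B1 * scale N ^ ?n * weight N (x - y k))"
        using B1_nonneg s weight_nonneg by (subst sum_ennreal[symmetric]) (auto simp: ennreal_mult)
      then show "ennreal (norm (fmult (\<eta> j) u x)) \<le> (\<Sum>k\<in>K'. ennreal (B1 * scale N ^ ?n) * ennreal (weight N (x - y k)))"
        using pw[of x] by (simp add: ennreal_leI)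
    qed
    also have "\<dots> = (\<Sum>k\<in>K'. ennreal (B1 * scale N ^ ?n) * ennreal ((2 * pi / scale N) ^ ?n))"
      by (subst nn_integral_sum) (auto simp: nn_integral_cmult nn_integral_weight_shift[OF K(2)])
    also have "\<dots> = (\<Sum>k\<in>K'. ennreal (B1 * (2 * pi) ^ ?n))"
      using s B1_nonneg by (simp add: power_divide flip: ennreal_mult)
    also have "\<dots> = ennreal (real (card K') * (B1 * (2 * pi) ^ ?n))"
      using B1_nonneg by (simp add: ennreal_mult ennreal_of_nat_eq_real_of_nat)
    also have "\<dots> \<le> ennreal (real nnear * B1 * (2 * pi) ^ ?n + 1)"
      using mult_right_mono[OF cK', of "B1 * (2 * pi) ^ ?n"] B1_nonneg by (intro ennreal_leI) (simp add: mult.assoc)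
    finally show ?thesis .
  qed
  have m: "fmult (\<eta> j) u \<in> borel_measurable lborel"
    unfolding eq by measurable
  have "Lp_norm lborel p (fmult (\<eta> j) u) \<le>
     ennreal (((real nnear * B1 * 2 ^ ?n + 1) * scale N ^ ?n) powr (1 - recip p) * (real nnear * B1 * (2 * pi) ^ ?n + 1) powr recip p)"
    using B1_nonneg by (intro Lp_norm_le_interpolation[OF m p sup L1]) (auto intro: add_nonneg_pos)
  also have "((real nnear * B1 * 2 ^ ?n + 1) * scale N ^ ?n) powr (1 - recip p) * (real nnear * B1 * (2 * pi) ^ ?n + 1) powr recip p
      = B2 p * real N powr (a * real ?n * (1 - recip p))"
  proof -
    have "scale N ^ ?n = real N powr (a * real ?n)"
      using K(2) by (simp add: scale_def powr_powr flip: powr_realpow)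
    then show ?thesis
      using B1_nonneg by (simp add: B2_def powr_mult powr_powr)
  qed
  finally show "Lp_norm lborel p (fmult (\<eta> j) u) \<le> ennreal (B2 p * real N powr (a * real ?n * (1 - recip p)))" .
qed

definition W :: "real \<Rightarrow> real" where
  "W \<sigma> = (1 + 2 * C) powr (- \<sigma>) + ((1 + 2 * C) * (1 + 2 * real CARD('n))) powr \<sigma>"

lemma mod_norm_superpos:
  assumes K: "K \<subseteq> lattice_cube N" "1 \<le> N" "K \<noteq> {}" and e: "\<And>k. \<bar>e k\<bar> \<le> 1" and p: "1 \<le> p" and q: "1 \<le> q"
    and \<sigma>: "s / (1 - \<alpha>) = \<sigma>"
  shows "mod_norm \<eta> \<alpha> s p q (inv_fourier (superpos K e y))
     \<le> ennreal (W \<sigma> * B2 p * real nnear powr recip q *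
          real N powr (\<sigma> + a * real CARD('n) * (1 - recip p)) * real (card K) powr recip q)"
proof -
  define J where "J = (\<Union>k\<in>K. near k)"
  have fin: "finite K" using K(1) finite_lattice_cube finite_subset by blast
  have J: "finite J" using fin finite_near by (simp add: J_def)
  have "card J \<le> (\<Sum>k\<in>K. card (near k))"
    unfolding J_def by (rule card_UN_le[OF fin])
  then have "real (card J) \<le> real (nnear * card K)"
    unfolding of_nat_le_iff by (simp add: card_near mult.commute)
  then have cJ: "real (card J) \<le> real nnear * real (card K)" by simp
  have pos: "0 < real nnear * real (card K)"
    using nnear_pos fin K(3) by (simp add: card_gt_0_iff)
  have Wj: "jbr (int_vec j) powr (s / (1 - \<alpha>)) \<le> W \<sigma> * real N powr \<sigma>" if "j \<in> J" for j
  proof -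
    from that obtain k where k: "k \<in> K" "j \<in> near k" by (auto simp: J_def)
    note b = jbr_near_cube[OF k(2) _ K(2)]
    show ?thesis
    proof (cases "0 \<le> \<sigma>")
      case True
      have "jbr (int_vec j) powr \<sigma> \<le> ((1 + 2 * C) * (1 + 2 * real CARD('n)) * real N) powr \<sigma>"
        using True b(2) k K jbr_ge_1[of "int_vec j"] by (intro powr_mono2) auto
      also have "\<dots> = ((1 + 2 * C) * (1 + 2 * real CARD('n))) powr \<sigma> * real N powr \<sigma>"
        using C by (subst powr_mult) auto
      also have "\<dots> \<le> W \<sigma> * real N powr \<sigma>"
        by (intro mult_right_mono) (auto simp: W_def)
      finally show ?thesis by (simp add: \<sigma>)
    next
      case False
      have "jbr (int_vec j) powr \<sigma> \<le> (real N / (1 + 2 * C)) powr \<sigma>"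
        using False b(1) k K C by (intro powr_mono2') auto
      also have "\<dots> = (1 + 2 * C) powr (- \<sigma>) * real N powr \<sigma>"
        using C by (simp add: powr_divide powr_minus field_simps)
      also have "\<dots> \<le> W \<sigma> * real N powr \<sigma>"
        by (intro mult_right_mono) (auto simp: W_def)
      finally show ?thesis by (simp add: \<sigma>)
    qed
  qed
  have "mod_norm \<eta> \<alpha> s p q (inv_fourier (superpos K e y))
    \<le> ennreal ((W \<sigma> * real N powr \<sigma>) * (B2 p * real N powr (a * real CARD('n) * (1 - recip p)))
        * (real nnear * real (card K)) powr recip q)"
  proof (rule mod_norm_le[OF q J cJ pos _ Wj])
    show "Lp_norm lborel p (fmult (\<eta> j) (inv_fourier (superpos K e y))) = 0" if "j \<notin> J" for j
      by (rule frequency_block_superpos(2)[OF K(1,2) e p]) (use that in \<open>auto simp: J_def\<close>)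
    show "Lp_norm lborel p (fmult (\<eta> j) (inv_fourier (superpos K e y)))
       \<le> ennreal (B2 p * real N powr (a * real CARD('n) * (1 - recip p)))" for j
      by (rule frequency_block_superpos(1)[OF K(1,2) e p])
  qed (auto simp: W_def B2_def)
  also have "(W \<sigma> * real N powr \<sigma>) * (B2 p * real N powr (a * real CARD('n) * (1 - recip p)))
        * (real nnear * real (card K)) powr recip q
     = W \<sigma> * B2 p * real nnear powr recip q *
          real N powr (\<sigma> + a * real CARD('n) * (1 - recip p)) * real (card K) powr recip q"
    by (simp add: powr_mult powr_add)
  finally show ?thesis .
qed

end

section \<open>Tools for the lower bounds\<close>

lemma powr_1_plus_bounds:
  fixes r \<theta> :: real
  assumes \<theta>: "0 < \<theta>" "\<theta> \<le> 1" and r: "\<bar>r\<bar> \<le> 1 / 2"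
  shows "\<bar>(1 + r) powr \<theta> - 1 - \<theta> * r\<bar> \<le> r\<^sup>2 / 2"
proof -
  have bern: "(1 + r) powr b \<le> 1 + b * r" if "0 \<le> b" "b \<le> 1" for b
    using Youngs_inequality_0[of b "1 - b" "1 + r" 1] that r by (simp add: algebra_simps abs_le_iff)
  have up: "(1 + r) powr \<theta> \<le> 1 + \<theta> * r" using bern \<theta> by simp
  have \<theta>r: "\<bar>(1 - \<theta>) * r\<bar> \<le> 1 * (1 / 2)"
    unfolding abs_mult using \<theta> r by (intro mult_mono) auto
  have pos: "0 < 1 + (1 - \<theta>) * r" using \<theta>r by (simp add: abs_le_iff)
  have "1 + r = (1 + r) powr \<theta> * (1 + r) powr (1 - \<theta>)"
    using r by (simp add: abs_le_iff flip: powr_add)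
  also have "\<dots> \<le> (1 + r) powr \<theta> * (1 + (1 - \<theta>) * r)"
    using bern[of "1 - \<theta>"] \<theta> by (intro mult_left_mono) auto
  finally have 1: "1 + r \<le> (1 + r) powr \<theta> * (1 + (1 - \<theta>) * r)" .
  have "\<theta> * (1 - \<theta>) \<le> 1 / 4"
    using zero_le_power2[of "\<theta> - 1 / 2"] by (simp add: power2_eq_square algebra_simps)
  also have "\<dots> \<le> (1 + (1 - \<theta>) * r) / 2" using \<theta>r by (simp add: abs_le_iff)
  finally have "\<theta> * (1 - \<theta>) * r\<^sup>2 \<le> (1 + (1 - \<theta>) * r) / 2 * r\<^sup>2"
    by (rule mult_right_mono) simp
  then have "(1 + \<theta> * r - r\<^sup>2 / 2) * (1 + (1 - \<theta>) * r) \<le> 1 + r"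
    by (simp add: field_simps power2_eq_square)
  with 1 have "(1 + \<theta> * r - r\<^sup>2 / 2) * (1 + (1 - \<theta>) * r) \<le> (1 + r) powr \<theta> * (1 + (1 - \<theta>) * r)"
    by simp
  then have "1 + \<theta> * r - r\<^sup>2 / 2 \<le> (1 + r) powr \<theta>"
    using pos by (simp add: mult_le_cancel_right)
  with up show ?thesis by (simp add: abs_le_iff)
qed

lemma norm_powr_taylor:
  fixes z h :: "'a::real_inner"
  assumes \<beta>: "0 < \<beta>" "\<beta> \<le> 2" and z: "z \<noteq> 0" and h: "norm h \<le> norm z / 8"
  shows "\<bar>norm (z + h) powr \<beta> - norm z powr \<beta> - \<beta> * norm z powr (\<beta> - 2) * (z \<bullet> h)\<bar>
     \<le> 6 * norm z powr (\<beta> - 2) * (norm h)\<^sup>2"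
proof -
  define D where "D = (norm z)\<^sup>2"
  define w where "w = 2 * (z \<bullet> h) + (norm h)\<^sup>2"
  define \<theta> where "\<theta> = \<beta> / 2"
  define Z where "Z = norm z powr (\<beta> - 2)"
  have nz: "0 < norm z" using z by simp
  have D: "0 < D" using nz by (simp add: D_def)
  have Z: "0 < Z" using nz by (simp add: Z_def)
  have nb: "norm x powr \<beta> = (norm x)\<^sup>2 powr \<theta>" for x :: 'a
    by (cases "x = 0") (simp_all add: \<theta>_def powr_powr flip: powr_numeral)
  have zh: "(norm (z + h))\<^sup>2 = D + w"
    by (simp add: D_def w_def power2_norm_eq_inner inner_add_left inner_add_right inner_commute)
  have "\<bar>w\<bar> \<le> 2 * (norm z * norm h) + (norm h)\<^sup>2"
    using Cauchy_Schwarz_ineq2[of z h] zero_le_power2[of "norm h"] unfolding w_def abs_le_iff by linarith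
  also have "(norm h)\<^sup>2 \<le> norm z * norm h"
    using h nz mult_right_mono[of "norm h" "norm z" "norm h"] by (simp add: power2_eq_square)
  finally have w3: "\<bar>w\<bar> \<le> 3 * norm z * norm h" by (simp add: mult_ac)
  also have "\<dots> \<le> 3 * norm z * (norm z / 8)"
    using h nz by (intro mult_left_mono) auto
  also have "\<dots> \<le> D / 2" using nz by (simp add: D_def power2_eq_square)
  finally have w2: "\<bar>w\<bar> \<le> D / 2" .
  define r where "r = w / D"
  have r: "\<bar>r\<bar> \<le> 1 / 2" using w2 D by (simp add: r_def field_simps)
  have Dw: "D + w = D * (1 + r)" using D by (simp add: r_def field_simps)
  have D\<theta>: "D powr \<theta> = Z * D"
  proof -
    have "D powr \<theta> = norm z powr \<beta>" unfolding D_def nb ..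
    also have "\<dots> = norm z powr (\<beta> - 2) * norm z powr 2" by (simp only: powr_add[symmetric]) simp
    finally show ?thesis using nz by (simp add: Z_def D_def)
  qed
  have "\<bar>D powr \<theta> * ((1 + r) powr \<theta> - 1 - \<theta> * r)\<bar> \<le> Z * D * (r\<^sup>2 / 2)"
    unfolding abs_mult D\<theta> using powr_1_plus_bounds[of \<theta> r] r \<beta> D Z
    by (intro mult_mono) (auto simp: \<theta>_def)
  also have "Z * D * (r\<^sup>2 / 2) = Z * (w\<^sup>2 / D) / 2"
    using D by (simp add: r_def power_divide power2_eq_square)
  also have "w\<^sup>2 / D \<le> 9 * (norm h)\<^sup>2"
  proof -
    have "w\<^sup>2 \<le> (3 * norm z * norm h)\<^sup>2"
      using power_mono[OF w3, of 2] by simp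
    then show ?thesis using D by (simp add: D_def power_mult_distrib divide_simps mult_ac)
  qed
  finally have 1: "\<bar>D powr \<theta> * ((1 + r) powr \<theta> - 1 - \<theta> * r)\<bar> \<le> Z * (9 * (norm h)\<^sup>2) / 2"
    using Z by simp
  have "norm (z + h) powr \<beta> - norm z powr \<beta> - \<beta> * Z * (z \<bullet> h)
     = D powr \<theta> * ((1 + r) powr \<theta> - 1 - \<theta> * r) + \<theta> * Z * (norm h)\<^sup>2"
  proof -
    have "norm (z + h) powr \<beta> = D powr \<theta> * (1 + r) powr \<theta>"
      unfolding nb zh Dw using D r by (intro powr_mult)
    moreover have "norm z powr \<beta> = D powr \<theta>" unfolding D_def nb ..
    moreover have "D powr \<theta> * (\<theta> * r) = \<theta> * Z * w"
      unfolding D\<theta> using D by (simp add: r_def)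
    moreover have "\<theta> * Z * w = \<beta> * Z * (z \<bullet> h) + \<theta> * Z * (norm h)\<^sup>2"
      by (simp add: w_def \<theta>_def algebra_simps)
    ultimately show ?thesis by (simp add: right_diff_distrib)
  qed
  moreover have "\<bar>\<theta> * Z * (norm h)\<^sup>2\<bar> \<le> 1 * Z * (norm h)\<^sup>2"
  proof -
    have "\<theta> * (Z * (norm h)\<^sup>2) \<le> 1 * (Z * (norm h)\<^sup>2)"
      using \<beta> Z by (intro mult_right_mono) (auto simp: \<theta>_def)
    then show ?thesis using \<beta> Z by (simp add: \<theta>_def abs_mult mult.assoc)
  qed
  ultimately have "\<bar>norm (z + h) powr \<beta> - norm z powr \<beta> - \<beta> * Z * (z \<bullet> h)\<bar>
     \<le> Z * (9 * (norm h)\<^sup>2) / 2 + 1 * Z * (norm h)\<^sup>2"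
    using 1 by linarith
  also have "\<dots> \<le> 6 * Z * (norm h)\<^sup>2"
    using Z by (simp add: algebra_simps)
  finally show ?thesis by (simp add: Z_def)
qed

lemma cos_ge_half: "\<bar>x\<bar> \<le> 1 \<Longrightarrow> 1 / 2 \<le> cos (x :: real)"
proof -
  assume "\<bar>x\<bar> \<le> 1"
  then have "cos (pi / 3) \<le> cos \<bar>x\<bar>"
    using pi_gt3 by (intro cos_monotone_0_pi_le) auto
  then show ?thesis by (simp add: cos_60)
qed

lemma cis_integral_lower:
  fixes \<Phi> :: "'a \<Rightarrow> real"
  assumes i: "integrable M \<Phi>" and nn: "\<And>x. 0 \<le> \<Phi> x"
    and [measurable]: "\<theta> \<in> borel_measurable M"
    and ph: "\<And>x. \<Phi> x \<noteq> 0 \<Longrightarrow> \<bar>\<theta> x - \<theta>0\<bar> \<le> 1"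
  shows "(\<integral>x. \<Phi> x \<partial>M) / 2 \<le> norm (\<integral>x. cis (\<theta> x) * complex_of_real (\<Phi> x) \<partial>M)"
proof -
  have [measurable]: "\<Phi> \<in> borel_measurable M" using i by auto
  have cm: "cis \<in> borel_measurable borel"
    by (intro borel_measurable_continuous_onI continuous_intros)
  have [measurable]: "(\<lambda>x. cis (\<theta> x - \<theta>0)) \<in> borel_measurable M"
    by (rule measurable_compose[OF _ cm]) measurable
  have int: "integrable M (\<lambda>x. cis (\<theta> x - \<theta>0) * complex_of_real (\<Phi> x))"
    by (rule Bochner_Integration.integrable_bound[OF i]) (auto simp: norm_mult)
  have "(\<integral>x. \<Phi> x \<partial>M) / 2 = (\<integral>x. 1 / 2 * \<Phi> x \<partial>M)" by simp
  also have "\<dots> \<le> (\<integral>x. Re (cis (\<theta> x - \<theta>0) * complex_of_real (\<Phi> x)) \<partial>M)"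
  proof (rule integral_mono)
    show "integrable M (\<lambda>x. Re (cis (\<theta> x - \<theta>0) * complex_of_real (\<Phi> x)))"
      using int by (rule integrable_Re)
    show "1 / 2 * \<Phi> x \<le> Re (cis (\<theta> x - \<theta>0) * complex_of_real (\<Phi> x))" for x
    proof (cases "\<Phi> x = 0")
      case False
      then have "1 / 2 * \<Phi> x \<le> cos (\<theta> x - \<theta>0) * \<Phi> x"
        using nn ph cos_ge_half by (intro mult_right_mono) auto
      then show ?thesis by simp
    qed simp
  qed (use i in simp)
  also have "\<dots> = Re (\<integral>x. cis (\<theta> x - \<theta>0) * complex_of_real (\<Phi> x) \<partial>M)"
    using int by (rule integral_Re)
  also have "\<dots> \<le> norm (\<integral>x. cis (\<theta> x - \<theta>0) * complex_of_real (\<Phi> x) \<partial>M)"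
    by (rule complex_Re_le_cmod)
  also have "(\<integral>x. cis (\<theta> x - \<theta>0) * complex_of_real (\<Phi> x) \<partial>M)
     = (\<integral>x. cis (- \<theta>0) * (cis (\<theta> x) * complex_of_real (\<Phi> x)) \<partial>M)"
    by (simp add: cis_mult mult.assoc[symmetric])
  also have "norm \<dots> = norm (\<integral>x. cis (\<theta> x) * complex_of_real (\<Phi> x) \<partial>M)"
    by (simp add: norm_mult)
  finally show ?thesis .
qed

lemma Lp_norm_lower:
  assumes E: "E \<in> sets M" and F: "\<And>z. z \<in> E \<Longrightarrow> m \<le> norm (F z)" and m: "0 \<le> m"
    and \<mu>: "ennreal \<mu> \<le> emeasure M E" "0 < \<mu>" and p: "1 \<le> p"
    and D: "Lp_norm M p F \<le> ennreal D" "0 \<le> D"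
  shows "m * \<mu> powr recip p \<le> D"
  using p
proof (cases rule: ereal_ge_1_cases)
  case 1
  have "m \<le> D"
  proof (rule ccontr)
    assume "\<not> m \<le> D"
    have "AE z in M. ennreal (norm (F z)) \<le> esssup M (\<lambda>z. ennreal (norm (F z)))"
      by (rule esssup_AE)
    then have "AE z in M. z \<notin> E"
    proof eventually_elim
      case (elim z)
      then have "ennreal (norm (F z)) \<le> ennreal D"
        using order_trans[OF elim] D(1) 1 by (simp add: Lp_norm_def)
      then have "norm (F z) \<le> D" using D by simp
      then show ?case using F[of z] \<open>\<not> m \<le> D\<close> by auto
    qed
    then have "E \<in> null_sets M" using E AE_iff_null_sets by blast
    then have "ennreal \<mu> \<le> 0" using \<mu> by (simp add: null_sets_def)
    then show False using \<mu> by simp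
  qed
  then show ?thesis using 1 \<mu> by (simp add: recip_def)
next
  case (2 P)
  let ?X = "\<integral>\<^sup>+z. ennreal (norm (F z) powr P) \<partial>M"
  have "epowr ?X (1 / P) \<le> ennreal D" using D 2 by (simp add: Lp_norm_def)
  then have up: "?X \<le> ennreal (D powr P)" using D 2 by (intro le_of_epowr_le) auto
  have "ennreal (m powr P * \<mu>) \<le> ennreal (m powr P) * emeasure M E"
    using \<mu> by (simp add: ennreal_mult mult_left_mono)
  also have "\<dots> = (\<integral>\<^sup>+z. ennreal (m powr P) * indicator E z \<partial>M)"
    using E by (simp add: nn_integral_cmult_indicator)
  also have "\<dots> \<le> ?X"
    using F m 2 by (intro nn_integral_mono) (auto simp: indicator_def intro!: ennreal_leI powr_mono2)
  finally have "ennreal (m powr P * \<mu>) \<le> ennreal (D powr P)" using up by (rule order_trans)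
  then have "m powr P * \<mu> \<le> D powr P" by simp
  then have "(m powr P * \<mu>) powr (1 / P) \<le> (D powr P) powr (1 / P)"
    using \<mu> 2 by (intro powr_mono2) auto
  then show ?thesis using m D \<mu> 2 by (simp add: powr_mult powr_powr recip_def)
qed

definition flip_sign :: "'a set \<Rightarrow> 'a \<Rightarrow> real" where
  "flip_sign S k = (if k \<in> S then - 1 else 1)"

text \<open>Pairing a choice of signs with the one that differs only at \<open>k0\<close> isolates \<open>f k0\<close>: one of
  the two sums is at least as large.\<close>

lemma sum_signs_lower:
  fixes f :: "'a \<Rightarrow> complex"
  assumes K: "finite K" "k0 \<in> K" and P: "1 \<le> P"
  shows "2 ^ card K * norm (f k0) powr P
     \<le> 2 * (\<Sum>S\<in>Pow K. norm (\<Sum>k\<in>K. complex_of_real (flip_sign S k) * f k) powr P)"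
proof -
  define \<phi> where "\<phi> S = (if k0 \<in> S then S - {k0} else insert k0 S)" for S
  define G where "G S = (\<Sum>k\<in>K. complex_of_real (flip_sign S k) * f k)" for S
  have bij: "bij_betw \<phi> (Pow K) (Pow K)"
    by (rule bij_betw_byWitness[where f'=\<phi>]) (use K in \<open>auto simp: \<phi>_def\<close>)
  have pair: "norm (f k0) powr P \<le> norm (G S) powr P + norm (G (\<phi> S)) powr P" for S
  proof -
    have split: "G T = complex_of_real (flip_sign T k0) * f k0 + (\<Sum>k\<in>K - {k0}. complex_of_real (flip_sign T k) * f k)" for T
      unfolding G_def using K by (simp add: sum.remove)
    have eq: "(\<Sum>k\<in>K - {k0}. complex_of_real (flip_sign (\<phi> S) k) * f k) = (\<Sum>k\<in>K - {k0}. complex_of_real (flip_sign S k) * f k)"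
      by (intro sum.cong) (auto simp: flip_sign_def \<phi>_def)
    have "G S - G (\<phi> S) = complex_of_real (2 * flip_sign S k0) * f k0"
      unfolding split eq by (auto simp: flip_sign_def \<phi>_def)
    then have "2 * norm (f k0) = norm (G S - G (\<phi> S))"
      by (simp add: norm_mult flip_sign_def)
    also have "\<dots> \<le> norm (G S) + norm (G (\<phi> S))" by (rule norm_triangle_ineq4)
    finally have "norm (f k0) \<le> norm (G S) \<or> norm (f k0) \<le> norm (G (\<phi> S))" by linarith
    then show ?thesis
    proof
      assume "norm (f k0) \<le> norm (G S)"
      then have "norm (f k0) powr P \<le> norm (G S) powr P" using P by (intro powr_mono2) auto
      then show ?thesis by (simp add: add_increasing2)
    next
      assume "norm (f k0) \<le> norm (G (\<phi> S))"
      then have "norm (f k0) powr P \<le> norm (G (\<phi> S)) powr P" using P by (intro powr_mono2) auto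
      then show ?thesis by (simp add: add_increasing)
    qed
  qed
  have "2 ^ card K * norm (f k0) powr P = (\<Sum>S\<in>Pow K. norm (f k0) powr P)"
    using K by (simp add: card_Pow)
  also have "\<dots> \<le> (\<Sum>S\<in>Pow K. norm (G S) powr P + norm (G (\<phi> S)) powr P)"
    by (intro sum_mono pair)
  also have "\<dots> = (\<Sum>S\<in>Pow K. norm (G S) powr P) + (\<Sum>S\<in>Pow K. norm (G (\<phi> S)) powr P)"
    by (rule sum.distrib)
  also have "(\<Sum>S\<in>Pow K. norm (G (\<phi> S)) powr P) = (\<Sum>S\<in>Pow K. norm (G S) powr P)"
    by (rule sum.reindex_bij_betw[OF bij])
  finally show ?thesis by (simp add: G_def)
qed

lemma powr_growth_le:
  assumes "\<And>N. N0 \<le> N \<Longrightarrow> b * real N powr x \<le> B * real N powr y" "0 < b"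
  shows "x \<le> y"
proof (rule ccontr)
  assume "\<not> x \<le> y"
  then have xy: "0 < x - y" by simp
  have "filterlim (\<lambda>N. real N powr (x - y)) at_top sequentially"
    using xy by real_asymp
  then have "eventually (\<lambda>N. B / b < real N powr (x - y)) sequentially"
    by (simp add: filterlim_at_top_dense)
  moreover have "eventually (\<lambda>N. N0 \<le> N \<and> 1 \<le> N) sequentially"
    by (intro eventually_conj eventually_ge_at_top)
  ultimately have "eventually (\<lambda>N. False) sequentially"
  proof eventually_elim
    case (elim N)
    then have pos: "0 < real N powr y" by simp
    have "real N powr x = real N powr (x - y) * real N powr y"
      using elim by (simp flip: powr_add)
    then have "b * real N powr (x - y) * real N powr y \<le> B * real N powr y"
      using assms(1)[of N] elim by (simp add: mult.assoc)
    then have "b * real N powr (x - y) \<le> B" using pos by simp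
    then show ?case using elim assms(2) by (simp add: field_simps)
  qed
  then show False by simp
qed

section \<open>Lower bounds for the flow\<close>

locale dispersive_packets = alpha_packets \<eta> a c c0 C A
  for \<eta> :: "int ^ 'n \<Rightarrow> real ^ 'n \<Rightarrow> complex" and a c c0 C A :: real +
  fixes \<beta> :: real
  assumes \<beta>: "0 < \<beta>" "\<beta> \<le> 2" and a_eq: "a = 2 / \<beta> - 1"
begin

lemma a\<beta>: "a * \<beta> = 2 - \<beta>" "(a + 1) * \<beta> = 2"
  using \<beta> by (simp_all add: a_eq field_simps)

lemma packet_eq_norm: "packet k \<xi> = complex_of_real ((norm (\<eta> k \<xi>))\<^sup>2)"
  unfolding packet_def by (rule complex_norm_square[symmetric])

lemma scale_le_jbr: "k \<in> lattice_cube N \<Longrightarrow> scale N \<le> jbr (int_vec k) powr a"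
  unfolding scale_def using lattice_cube_bounds(2)[of k N] a by (intro powr_mono2) auto

definition b0 :: real where
  "b0 = c0\<^sup>2 * unit_ball_vol (real CARD('n)) * c ^ CARD('n)"

definition b1 :: real where
  "b1 = (2 * pi) powr (- real CARD('n)) * b0 / 2"

lemma b1_pos: "0 < b1"
  using c c0 by (auto simp: b0_def b1_def intro!: mult_pos_pos unit_ball_vol_pos)

lemma packet_mass:
  assumes k: "k \<in> lattice_cube N" "1 \<le> N"
  shows "integrable lborel (\<lambda>\<xi>. (norm (\<eta> k \<xi>))\<^sup>2)"
    and "b0 * scale N ^ CARD('n) \<le> (\<integral>\<xi>. (norm (\<eta> k \<xi>))\<^sup>2 \<partial>lborel)"
proof -
  have "integrable lborel (\<lambda>\<xi>. 1 * packet k \<xi>)"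
    by (rule integrable_mult_packet[OF _ _ k, where M=1]) auto
  then have "integrable lborel (\<lambda>\<xi>. norm (packet k \<xi>))"
    by (intro integrable_norm) simp
  then show i: "integrable lborel (\<lambda>\<xi>. (norm (\<eta> k \<xi>))\<^sup>2)"
    by (simp add: packet_def norm_mult power2_eq_square)
  let ?B = "ball (ctr k) (c * scale N)"
  have fin: "emeasure lborel ?B < \<infinity>"
    by (rule emeasure_lborel_ball_finite)
  have "b0 * scale N ^ CARD('n) = c0\<^sup>2 * measure lborel ?B"
    using content_ball[of "c * scale N" "ctr k"] c scale_pos[OF k(2)] by (simp add: b0_def power_mult_distrib)
  also have "\<dots> = (\<integral>\<xi>. c0\<^sup>2 * indicator ?B \<xi> \<partial>lborel)" by simp
  also have "\<dots> \<le> (\<integral>\<xi>. (norm (\<eta> k \<xi>))\<^sup>2 \<partial>lborel)"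
  proof (rule integral_mono[OF _ i])
    show "integrable lborel (\<lambda>\<xi>. c0\<^sup>2 * indicator ?B \<xi>)"
      using fin by (intro integrable_mult_right integrable_real_indicator) auto
    show "c0\<^sup>2 * indicator ?B \<xi> \<le> (norm (\<eta> k \<xi>))\<^sup>2" for \<xi>
    proof (cases "\<xi> \<in> ?B")
      case True
      then have "dist \<xi> (ctr k) < c * scale N" by (simp add: dist_commute)
      also have "\<dots> \<le> c * jbr (int_vec k) powr a"
        using c scale_le_jbr[OF k(1)] by (intro mult_left_mono) auto
      finally have "c0 \<le> norm (\<eta> k \<xi>)" using lower[of \<xi> k] by (simp add: ctr_def)
      then show ?thesis using c0 True by (simp add: power_mono)
    qed simp
  qed
  finally show "b0 * scale N ^ CARD('n) \<le> (\<integral>\<xi>. (norm (\<eta> k \<xi>))\<^sup>2 \<partial>lborel)" .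
qed

lemma inv_fourier_flow:
  "inv_fourier (\<lambda>\<xi>. cis (t * norm \<xi> powr \<beta>) * \<Phi> \<xi>) x =
     complex_of_real ((2 * pi) powr (- real CARD('n))) * (\<integral>\<xi>. cis (x \<bullet> \<xi> + t * norm \<xi> powr \<beta>) * \<Phi> \<xi> \<partial>lborel)"
  for x :: "real ^ 'n"
  unfolding inv_fourier_def by (simp add: mult.assoc flip: cis_mult)

lemma flow_lower:
  fixes \<Phi> :: "real ^ 'n \<Rightarrow> real"
  assumes "integrable lborel \<Phi>" "\<And>\<xi>. 0 \<le> \<Phi> \<xi>"
    and "\<And>\<xi>. \<Phi> \<xi> \<noteq> 0 \<Longrightarrow> \<bar>x \<bullet> \<xi> + t * norm \<xi> powr \<beta> - \<theta>0\<bar> \<le> 1"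
    and "m \<le> (\<integral>\<xi>. \<Phi> \<xi> \<partial>lborel)"
  shows "(2 * pi) powr (- real CARD('n)) * m / 2
     \<le> norm (inv_fourier (\<lambda>\<xi>. cis (t * norm \<xi> powr \<beta>) * complex_of_real (\<Phi> \<xi>)) x)"
proof -
  have "m / 2 \<le> norm (\<integral>\<xi>. cis (x \<bullet> \<xi> + t * norm \<xi> powr \<beta>) * complex_of_real (\<Phi> \<xi>) \<partial>lborel)"
    using assms(4) cis_integral_lower[of lborel \<Phi> "\<lambda>\<xi>. x \<bullet> \<xi> + t * norm \<xi> powr \<beta>" \<theta>0,
      OF assms(1,2) _ assms(3)] by simp
  then have "(2 * pi) powr (- real CARD('n)) * (m / 2) \<le> (2 * pi) powr (- real CARD('n)) *
     norm (\<integral>\<xi>. cis (x \<bullet> \<xi> + t * norm \<xi> powr \<beta>) * complex_of_real (\<Phi> \<xi>) \<partial>lborel)"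
    by (intro mult_left_mono) auto
  then show ?thesis
    unfolding inv_fourier_flow by (simp add: norm_mult)
qed

definition \<delta> :: real where "\<delta> = 1 / (C2 + 24 * C\<^sup>2 + 1)"

lemma \<delta>: "0 < \<delta>" "\<delta> \<le> 1" "\<delta> * (C2 + 24 * C\<^sup>2) \<le> 1"
proof -
  have "0 \<le> C2 + 24 * C\<^sup>2" using C2 by simp
  then show "0 < \<delta>" "\<delta> \<le> 1" "\<delta> * (C2 + 24 * C\<^sup>2) \<le> 1"
    unfolding \<delta>_def by (auto simp: divide_simps)
qed

definition vel :: "int ^ 'n \<Rightarrow> real ^ 'n" where
  "vel k = (\<beta> * norm (ctr k) powr (\<beta> - 2)) *\<^sub>R ctr k"

text \<open>On the support of a packet the phase is affine up to a bounded error: this is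
  where \<open>\<alpha> = 1 - \<beta> / 2\<close> is used.\<close>

lemma phase_linearisation:
  assumes k: "k \<in> lattice_cube N" "1 \<le> N" "8 * C \<le> real N" and \<xi>: "packet k \<xi> \<noteq> 0"
  shows "\<bar>norm \<xi> powr \<beta> - norm (ctr k) powr \<beta> - vel k \<bullet> (\<xi> - ctr k)\<bar> \<le> 24 * C\<^sup>2"
proof -
  define h where "h = \<xi> - ctr k"
  define j where "j = jbr (int_vec k)"
  define n where "n = norm (int_vec k)"
  have n: "real N \<le> n" "1 \<le> n" using lattice_cube_bounds(1)[OF k(1)] k(2) by (auto simp: n_def)
  have j: "1 \<le> j" "j \<le> 2 * n"
    using jbr_ge_1[of "int_vec k"] jbr_le_1_plus_norm[of "int_vec k"] n by (auto simp: j_def n_def)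
  have nc: "norm (ctr k) = j powr a * n" by (simp add: ctr_def j_def n_def)
  have "dist \<xi> (ctr k) < C * j powr a"
    using \<xi> supp[of k \<xi>] by (auto simp: packet_def ctr_def j_def)
  then have h: "norm h \<le> C * j powr a" by (simp add: h_def dist_norm)
  also have "\<dots> \<le> (n / 8) * j powr a"
    using k(3) n by (intro mult_right_mono) auto
  finally have h8: "norm h \<le> norm (ctr k) / 8" by (simp add: nc mult.commute)
  have nz: "ctr k \<noteq> 0"
  proof -
    have "0 < norm (ctr k)" unfolding nc using j n by simp
    then show ?thesis by auto
  qed
  have "\<bar>norm (ctr k + h) powr \<beta> - norm (ctr k) powr \<beta> - \<beta> * norm (ctr k) powr (\<beta> - 2) * (ctr k \<bullet> h)\<bar>
     \<le> 6 * norm (ctr k) powr (\<beta> - 2) * (norm h)\<^sup>2"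
    by (rule norm_powr_taylor[OF \<beta> nz h8])
  also have "\<dots> \<le> 6 * norm (ctr k) powr (\<beta> - 2) * (C * j powr a)\<^sup>2"
    using h by (intro mult_left_mono power_mono) auto
  also have "\<dots> = 6 * C\<^sup>2 * (norm (ctr k) powr (\<beta> - 2) * (j powr a)\<^sup>2)"
    by (simp add: power_mult_distrib)
  also have "norm (ctr k) powr (\<beta> - 2) * (j powr a)\<^sup>2 = j powr (2 - \<beta>) * n powr (\<beta> - 2)"
  proof -
    have "(j powr a)\<^sup>2 = j powr (2 * a)"
      using j by (simp add: powr_powr mult.commute flip: powr_numeral)
    moreover have "norm (ctr k) powr (\<beta> - 2) = j powr (a * (\<beta> - 2)) * n powr (\<beta> - 2)"
      unfolding nc using j n by (simp add: powr_mult powr_powr)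
    moreover have "j powr (a * (\<beta> - 2)) * j powr (2 * a) = j powr (2 - \<beta>)"
      unfolding powr_add[symmetric] a\<beta>(1)[symmetric] by (simp add: algebra_simps)
    ultimately show ?thesis by (simp add: mult_ac)
  qed
  also have "\<dots> \<le> 4 * n powr (2 - \<beta>) * n powr (\<beta> - 2)"
  proof (rule mult_right_mono)
    have "j powr (2 - \<beta>) \<le> (2 * n) powr (2 - \<beta>)"
      using j \<beta> by (intro powr_mono2) auto
    also have "\<dots> = 2 powr (2 - \<beta>) * n powr (2 - \<beta>)" using n by (simp add: powr_mult)
    also have "\<dots> \<le> 2 powr 2 * n powr (2 - \<beta>)"
      using \<beta> by (intro mult_right_mono powr_mono) auto
    finally show "j powr (2 - \<beta>) \<le> 4 * n powr (2 - \<beta>)" by simp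
  qed simp
  also have "\<dots> = 4" using n by (simp add: mult.assoc flip: powr_add)
  finally have "\<bar>norm (ctr k + h) powr \<beta> - norm (ctr k) powr \<beta> - \<beta> * norm (ctr k) powr (\<beta> - 2) * (ctr k \<bullet> h)\<bar> \<le> 24 * C\<^sup>2"
    by (simp add: mult_left_mono)
  then show ?thesis by (simp add: h_def vel_def)
qed

lemma packet_flow_lower:
  assumes k: "k \<in> lattice_cube N" "1 \<le> N" "8 * C \<le> real N"
    and t: "0 \<le> t" "t \<le> \<delta>" and x: "norm (x + t *\<^sub>R vel k) \<le> \<delta> / scale N"
  shows "b1 * scale N ^ CARD('n) \<le> norm (inv_fourier (\<lambda>\<xi>. cis (t * norm \<xi> powr \<beta>) * packet k \<xi>) x)"
proof -
  define y where "y = x + t *\<^sub>R vel k"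
  have s: "0 < scale N" using k(2) by (rule scale_pos)
  have "\<bar>x \<bullet> \<xi> + t * norm \<xi> powr \<beta> - (x \<bullet> ctr k + t * norm (ctr k) powr \<beta>)\<bar> \<le> 1"
    if "(norm (\<eta> k \<xi>))\<^sup>2 \<noteq> 0" for \<xi>
  proof -
    have \<xi>: "packet k \<xi> \<noteq> 0" using that by (simp add: packet_eq_norm)
    have "dist (ctr k) \<xi> \<le> C2 * scale N" using packet_supp[OF k(1,2), of \<xi>] \<xi> by auto
    then have h: "norm (\<xi> - ctr k) \<le> C2 * scale N" by (simp add: dist_norm norm_minus_commute)
    have "x \<bullet> \<xi> + t * norm \<xi> powr \<beta> - (x \<bullet> ctr k + t * norm (ctr k) powr \<beta>)
      = y \<bullet> (\<xi> - ctr k) + t * (norm \<xi> powr \<beta> - norm (ctr k) powr \<beta> - vel k \<bullet> (\<xi> - ctr k))"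
      by (simp add: y_def inner_add_left inner_diff_right algebra_simps)
    moreover have "\<bar>y \<bullet> (\<xi> - ctr k)\<bar> \<le> \<delta> * C2"
    proof -
      have "\<bar>y \<bullet> (\<xi> - ctr k)\<bar> \<le> norm y * norm (\<xi> - ctr k)" by (rule Cauchy_Schwarz_ineq2)
      also have "\<dots> \<le> (\<delta> / scale N) * (C2 * scale N)"
        using x h \<delta> s C2 by (intro mult_mono) (auto simp: y_def)
      also have "\<dots> = \<delta> * C2" using s by simp
      finally show ?thesis .
    qed
    moreover have "\<bar>t * (norm \<xi> powr \<beta> - norm (ctr k) powr \<beta> - vel k \<bullet> (\<xi> - ctr k))\<bar> \<le> \<delta> * (24 * C\<^sup>2)"
      unfolding abs_mult using t phase_linearisation[OF k \<xi>] \<delta> by (intro mult_mono) auto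
    ultimately have "\<bar>x \<bullet> \<xi> + t * norm \<xi> powr \<beta> - (x \<bullet> ctr k + t * norm (ctr k) powr \<beta>)\<bar> \<le> \<delta> * C2 + \<delta> * (24 * C\<^sup>2)"
      by linarith
    also have "\<dots> \<le> 1" using \<delta>(3) by (simp add: distrib_left)
    finally show ?thesis .
  qed
  from flow_lower[OF packet_mass(1)[OF k(1,2)] _ this packet_mass(2)[OF k(1,2)]]
  show ?thesis by (simp add: packet_eq_norm b1_def mult_ac)
qed

definition Q :: real where "Q = (1 + 2 * real CARD('n)) powr (a + 1) + C2"

lemma Q_pos: "0 < Q" using C2 by (simp add: Q_def add_nonneg_pos)

lemma packet_norm_le:
  assumes k: "k \<in> lattice_cube N" "1 \<le> N" and \<xi>: "packet k \<xi> \<noteq> 0"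
  shows "norm \<xi> \<le> Q * real N powr (a + 1)"
proof -
  have "dist (ctr k) \<xi> \<le> C2 * scale N" using packet_supp[OF k, of \<xi>] \<xi> by auto
  then have h: "norm (\<xi> - ctr k) \<le> C2 * scale N" by (simp add: dist_norm norm_minus_commute)
  have j: "1 \<le> jbr (int_vec k)" by (rule jbr_ge_1)
  have "norm (ctr k) \<le> jbr (int_vec k) powr a * jbr (int_vec k)"
    by (simp add: ctr_def norm_le_jbr mult_left_mono)
  also have "\<dots> = jbr (int_vec k) powr (a + 1)" using j by (simp add: powr_add)
  also have "\<dots> \<le> ((1 + 2 * real CARD('n)) * real N) powr (a + 1)"
    using lattice_cube_bounds(3)[OF k] j a by (intro powr_mono2) auto
  also have "\<dots> = (1 + 2 * real CARD('n)) powr (a + 1) * real N powr (a + 1)"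
    by (rule powr_mult)
  finally have 1: "norm (ctr k) \<le> (1 + 2 * real CARD('n)) powr (a + 1) * real N powr (a + 1)" .
  have "C2 * scale N \<le> C2 * real N powr (a + 1)"
    unfolding scale_def using C2 k(2) by (intro mult_left_mono powr_mono) auto
  then have "norm \<xi> \<le> (1 + 2 * real CARD('n)) powr (a + 1) * real N powr (a + 1) + C2 * real N powr (a + 1)"
    using 1 h norm_triangle_sub[of \<xi> "ctr k"] by linarith
  then show ?thesis by (simp add: Q_def distrib_right)
qed

lemma superpos_flow_lower:
  assumes K: "K \<subseteq> lattice_cube N" "1 \<le> N"
    and t: "0 \<le> t" "t * (Q powr \<beta> * (real N)\<^sup>2) \<le> 1 / 2"
    and x: "norm x * (Q * real N powr (a + 1)) \<le> 1 / 2"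
  shows "real (card K) * b1 * scale N ^ CARD('n)
    \<le> norm (inv_fourier (\<lambda>\<xi>. cis (t * norm \<xi> powr \<beta>) * superpos K (\<lambda>_. 1) (\<lambda>_. 0) \<xi>) x)"
proof -
  let ?\<Phi> = "\<lambda>\<xi>. \<Sum>k\<in>K. (norm (\<eta> k \<xi>))\<^sup>2"
  have sp: "superpos K (\<lambda>_. 1) (\<lambda>_. 0) \<xi> = complex_of_real (?\<Phi> \<xi>)" for \<xi>
    by (simp add: superpos_def packet_eq_norm)
  have i: "integrable lborel (\<lambda>\<xi>. (norm (\<eta> k \<xi>))\<^sup>2)" if "k \<in> K" for k
    using packet_mass(1) that K by blast
  have "(\<Sum>k\<in>K. b0 * scale N ^ CARD('n)) \<le> (\<Sum>k\<in>K. \<integral>\<xi>. (norm (\<eta> k \<xi>))\<^sup>2 \<partial>lborel)"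
    using packet_mass(2) K by (intro sum_mono) auto
  also have "\<dots> = (\<integral>\<xi>. ?\<Phi> \<xi> \<partial>lborel)"
    using i by (subst Bochner_Integration.integral_sum) auto
  finally have mass: "real (card K) * (b0 * scale N ^ CARD('n)) \<le> (\<integral>\<xi>. ?\<Phi> \<xi> \<partial>lborel)" by simp
  have "\<bar>x \<bullet> \<xi> + t * norm \<xi> powr \<beta> - 0\<bar> \<le> 1" if "?\<Phi> \<xi> \<noteq> 0" for \<xi>
  proof -
    from that obtain k where "k \<in> K" "(norm (\<eta> k \<xi>))\<^sup>2 \<noteq> 0"
      using sum.not_neutral_contains_not_neutral by blast
    then have n: "norm \<xi> \<le> Q * real N powr (a + 1)"
      using K by (intro packet_norm_le[of k]) (auto simp: packet_eq_norm)
    have "\<bar>x \<bullet> \<xi>\<bar> \<le> norm x * norm \<xi>" by (rule Cauchy_Schwarz_ineq2)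
    also have "\<dots> \<le> norm x * (Q * real N powr (a + 1))" using n by (intro mult_left_mono) auto
    finally have 1: "\<bar>x \<bullet> \<xi>\<bar> \<le> 1 / 2" using x by simp
    have "norm \<xi> powr \<beta> \<le> (Q * real N powr (a + 1)) powr \<beta>"
      using n \<beta> by (intro powr_mono2) auto
    also have "\<dots> = Q powr \<beta> * (real N)\<^sup>2"
      using Q_pos K(2) by (simp add: powr_mult powr_powr a\<beta>(2))
    finally have "t * norm \<xi> powr \<beta> \<le> t * (Q powr \<beta> * (real N)\<^sup>2)"
      using t by (intro mult_left_mono) auto
    moreover have "0 \<le> t * norm \<xi> powr \<beta>" using t by simp
    ultimately show ?thesis using 1 t by linarith
  qed
  from flow_lower[OF _ _ this mass] i
  show ?thesis by (simp add: sp b1_def mult_ac sum_nonneg)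
qed

lemma S_beta_superpos:
  assumes "K \<subseteq> lattice_cube N" "1 \<le> N" "\<And>k. \<bar>e k\<bar> \<le> 1"
  shows "S_beta \<beta> t (inv_fourier (superpos K e y)) = inv_fourier (\<lambda>\<xi>. cis (t * norm \<xi> powr \<beta>) * superpos K e y \<xi>)"
  unfolding S_beta_def fmult_def fourier_superpos[OF assms] ..

definition b2 :: real where
  "b2 = 1 / (2 * Q powr \<beta> + 1) * (unit_ball_vol (real CARD('n)) * (1 / (2 * Q)) ^ CARD('n))"

lemma b2_pos: "0 < b2"
  using Q_pos by (auto simp: b2_def intro!: mult_pos_pos divide_pos_pos add_nonneg_pos unit_ball_vol_pos)

lemma concentration_lower:
  assumes K: "K \<subseteq> lattice_cube N" "1 \<le> N" and p: "1 \<le> p"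
    and D: "st_norm p (\<lambda>t. S_beta \<beta> t (inv_fourier (superpos K (\<lambda>_. 1) (\<lambda>_. 0)))) \<le> ennreal D" "0 \<le> D"
  shows "real (card K) * b1 * scale N ^ CARD('n) *
     (b2 * real N powr (- 2 - (a + 1) * real CARD('n))) powr recip p \<le> D"
proof -
  let ?n = "CARD('n)"
  let ?M = "restrict_space lborel ({0..1} \<times> UNIV) :: (real \<times> (real ^ 'n)) measure"
  define B where "B = Q powr \<beta>"
  define t0 where "t0 = 1 / (2 * B + 1) * real N powr (- 2)"
  define r0 where "r0 = 1 / (2 * Q) * real N powr (- (a + 1))"
  have Np: "1 \<le> real N" using K(2) by simp
  have B: "0 < B" using Q_pos by (simp add: B_def)
  have t0: "0 < t0" "t0 \<le> 1" "t0 * (B * (real N)\<^sup>2) \<le> 1 / 2"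
  proof -
    have N2: "real N powr (- 2) * (real N)\<^sup>2 = 1" using Np by (simp add: powr_minus)
    have "real N powr (- 2) \<le> 1" using Np by (simp add: powr_minus inverse_le_1_iff)
    then show "t0 \<le> 1" unfolding t0_def using B by (intro mult_le_one) auto
    show "0 < t0" using Np B by (simp add: t0_def)
    have "t0 * (B * (real N)\<^sup>2) = B / (2 * B + 1) * (real N powr (- 2) * (real N)\<^sup>2)"
      unfolding t0_def by simp
    also have "\<dots> \<le> 1 / 2" unfolding N2 using B by (simp add: divide_simps)
    finally show "t0 * (B * (real N)\<^sup>2) \<le> 1 / 2" .
  qed
  have r0: "0 < r0" "r0 * (Q * real N powr (a + 1)) \<le> 1 / 2"
  proof -
    show "0 < r0" using Np Q_pos by (simp add: r0_def)
    have "r0 * (Q * real N powr (a + 1)) = 1 / 2 * (real N powr (- (a + 1)) * real N powr (a + 1))"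
      using Q_pos by (simp add: r0_def)
    also have "real N powr (- (a + 1)) * real N powr (a + 1) = 1"
      using Np by (simp flip: powr_add)
    finally show "r0 * (Q * real N powr (a + 1)) \<le> 1 / 2" by simp
  qed
  define E where "E = {0..t0} \<times> cball (0 :: real ^ 'n) r0"
  have sub: "E \<subseteq> {0..1} \<times> UNIV" using t0 by (auto simp: E_def)
  have Em: "E \<in> sets lborel" unfolding E_def by (simp add: borel_closed closed_Times)
  have Om: "{0..1 :: real} \<times> (UNIV :: (real ^ 'n) set) \<in> sets lborel"
    unfolding sets_lborel by (intro borel_closed closed_Times closed_UNIV closed_atLeastAtMost)
  have "emeasure ?M E = emeasure lborel E"
    using sub Om by (intro emeasure_restrict_space) auto
  also have "\<dots> = emeasure (lborel \<Otimes>\<^sub>M lborel) ({0..t0} \<times> cball (0 :: real ^ 'n) r0)"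
    by (simp add: E_def lborel_prod)
  also have "\<dots> = ennreal t0 * ennreal (unit_ball_vol (real ?n) * r0 ^ ?n)"
    using t0 r0 by (subst lborel.emeasure_pair_measure_Times) (auto simp: emeasure_cball)
  also have "\<dots> = ennreal (b2 * real N powr (- 2 - (a + 1) * real ?n))"
  proof -
    have "t0 * (unit_ball_vol (real ?n) * r0 ^ ?n) = b2 * (real N powr (- 2) * (real N powr (- (a + 1))) ^ ?n)"
      by (simp add: t0_def r0_def b2_def B_def power_mult_distrib power_divide)
    also have "real N powr (- 2) * (real N powr (- (a + 1))) ^ ?n = real N powr (- 2 - (a + 1) * real ?n)"
    proof -
      have "(real N powr (- (a + 1))) ^ ?n = real N powr (- (a + 1) * real ?n)"
        using Np by (simp add: powr_powr flip: powr_realpow)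
      then show ?thesis
        unfolding powr_add[symmetric]
        by (simp only: powr_add[symmetric]) (rule arg_cong[where f="\<lambda>e. real N powr e"], simp add: algebra_simps)
    qed
    finally show ?thesis using t0 r0 by (simp flip: ennreal_mult)
  qed
  finally have \<mu>: "ennreal (b2 * real N powr (- 2 - (a + 1) * real ?n)) \<le> emeasure ?M E" by simp
  show ?thesis
  proof (rule Lp_norm_lower[OF _ _ _ \<mu> _ p D(1)[unfolded st_norm_def] D(2)])
    show "E \<in> sets ?M" using Em Om sub by (subst sets_restrict_space_iff) auto
    show "0 \<le> real (card K) * b1 * scale N ^ ?n" using b1_pos scale_pos[OF K(2)] by simp
    show "0 < b2 * real N powr (- 2 - (a + 1) * real ?n)" using b2_pos Np by simp
    fix z assume "z \<in> E"
    then obtain t x where z: "z = (t, x)" "0 \<le> t" "t \<le> t0" "norm x \<le> r0" by (auto simp: E_def)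
    have "t * (B * (real N)\<^sup>2) \<le> t0 * (B * (real N)\<^sup>2)"
      using z B by (intro mult_right_mono) auto
    moreover have "norm x * (Q * real N powr (a + 1)) \<le> r0 * (Q * real N powr (a + 1))"
      using z Q_pos by (intro mult_right_mono) auto
    ultimately show "real (card K) * b1 * scale N ^ ?n
      \<le> norm (case z of (t, x) \<Rightarrow> S_beta \<beta> t (inv_fourier (superpos K (\<lambda>_. 1) (\<lambda>_. 0))) x)"
      using superpos_flow_lower[OF K, of t x] z t0(3) r0(2) S_beta_superpos[OF K, of "\<lambda>_. 1"]
      by (simp add: B_def)
  qed
qed


lemma flow_packet_measurable:
  "(\<lambda>z :: real \<times> (real ^ 'n). inv_fourier (\<lambda>\<xi>. cis (fst z * norm \<xi> powr \<beta>) * packet k \<xi>) (snd z - y)) \<in> borel_measurable borel"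
proof -
  have cm: "cis \<in> borel_measurable borel"
    by (intro borel_measurable_continuous_onI continuous_intros)
  have "(\<lambda>w :: (real \<times> (real ^ 'n)) \<times> (real ^ 'n). (snd (fst w) - y) \<bullet> snd w + fst (fst w) * norm (snd w) powr \<beta>)
      \<in> borel_measurable (borel \<Otimes>\<^sub>M borel)"
    unfolding borel_prod[symmetric] by measurable
  from measurable_compose[OF this cm]
  have [measurable]: "(\<lambda>w :: (real \<times> (real ^ 'n)) \<times> (real ^ 'n). cis ((snd (fst w) - y) \<bullet> snd w + fst (fst w) * norm (snd w) powr \<beta>))
      \<in> borel_measurable (borel \<Otimes>\<^sub>M borel)" .
  have "(\<lambda>z :: real \<times> (real ^ 'n). \<integral>\<xi>. cis ((snd z - y) \<bullet> \<xi> + fst z * norm \<xi> powr \<beta>) * packet k \<xi> \<partial>lborel) \<in> borel_measurable borel"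
    by (rule lborel.borel_measurable_lebesgue_integral) (simp add: split_def)
  then show ?thesis
    unfolding inv_fourier_flow by measurable
qed

lemma spread_lower:
  assumes K: "K \<subseteq> lattice_cube N" "1 \<le> N" "8 * C \<le> real N" and P: "1 \<le> P" and D0: "0 \<le> D"
    and D: "\<And>e y. (\<And>k. \<bar>e k\<bar> \<le> 1) \<Longrightarrow>
       st_norm (ereal P) (\<lambda>t. S_beta \<beta> t (inv_fourier (superpos K e y))) \<le> ennreal D"
  shows "real (card K) * ((b1 * scale N ^ CARD('n)) powr P *
     (\<delta> * (unit_ball_vol (real CARD('n)) * (\<delta> / scale N) ^ CARD('n)))) \<le> 2 * D powr P"
proof -
  let ?n = "CARD('n)"
  let ?M = "restrict_space lborel ({0..1} \<times> UNIV) :: (real \<times> (real ^ 'n)) measure"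
  have fin: "finite K" using K(1) finite_lattice_cube finite_subset by blast
  \<comment> \<open>\<open>L\<close> separates the packets so far that their space-time tubes \<open>E k\<close> stay disjoint.\<close>
  define L where "L = 3 + 2 * (\<Sum>k\<in>K. norm (vel k))"
  define y where "y k = L *\<^sub>R int_vec k" for k :: "int ^ 'n"
  define f where "f k z = inv_fourier (\<lambda>\<xi>. cis (fst z * norm \<xi> powr \<beta>) * packet k \<xi>) (snd z - y k)" for k and z :: "real \<times> (real ^ 'n)"
  define F where "F S z = S_beta \<beta> (fst z) (inv_fourier (superpos K (flip_sign S) y)) (snd z)" for S z
  define m where "m = b1 * scale N ^ ?n"
  define V where "V = unit_ball_vol (real ?n) * (\<delta> / scale N) ^ ?n"
  have s: "0 < scale N" "1 \<le> scale N"
    using K(2) a by (auto simp: scale_def ge_one_powr_ge_zero)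
  have m: "0 < m" using b1_pos s by (simp add: m_def)
  have V: "0 \<le> V" using \<delta> s by (simp add: V_def unit_ball_vol_nonneg)
  have fs: "\<bar>flip_sign S k\<bar> \<le> 1" for S :: "(int ^ 'n) set" and k by (simp add: flip_sign_def)
  have F_eq: "F S z = (\<Sum>k\<in>K. complex_of_real (flip_sign S k) * f k z)" for S z
    unfolding F_def f_def S_beta_superpos[OF K(1,2) fs]
  proof (rule inv_fourier_mult_superpos[OF _ _ K(1,2)])
    have cm: "cis \<in> borel_measurable borel"
      by (intro borel_measurable_continuous_onI continuous_intros)
    show "(\<lambda>\<xi> :: real ^ 'n. cis (fst z * norm \<xi> powr \<beta>)) \<in> borel_measurable borel"
      by (rule measurable_compose[OF _ cm]) measurable
    show "norm (cis (fst z * norm \<xi> powr \<beta>)) \<le> 1" for \<xi> :: "real ^ 'n" by simp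
  qed
  have fm: "f k \<in> borel_measurable borel" for k
    unfolding f_def by (rule flow_packet_measurable)
  have Fm: "F S \<in> borel_measurable borel" for S
    unfolding F_eq[abs_def] using fm by measurable
  have FM: "F S \<in> borel_measurable ?M" for S
    using Fm[of S] by (intro measurable_restrict_space1) simp
  have up: "(\<integral>\<^sup>+z. ennreal (norm (F S z) powr P) \<partial>?M) \<le> ennreal (D powr P)" for S
  proof (rule le_of_epowr_le[OF _ _ D0])
    show "epowr (\<integral>\<^sup>+z. ennreal (norm (F S z) powr P) \<partial>?M) (1 / P) \<le> ennreal D"
      using D[of "flip_sign S" y] fs by (simp add: st_norm_def Lp_norm_def F_def case_prod_beta)
  qed (use P in auto)
  define E where "E k = {z :: real \<times> (real ^ 'n). 0 \<le> fst z \<and> fst z \<le> \<delta> \<and> norm (snd z - y k + fst z *\<^sub>R vel k) \<le> \<delta> / scale N}" for k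
  have Om: "{0..1 :: real} \<times> (UNIV :: (real ^ 'n) set) \<in> sets lborel"
    unfolding sets_lborel by (intro borel_closed closed_Times closed_UNIV closed_atLeastAtMost)
  have Ecl: "closed (E k)" for k
    unfolding E_def by (intro closed_Collect_conj closed_Collect_le continuous_intros)
  then have Eb: "E k \<in> sets lborel" for k by (simp add: borel_closed)
  have Esub: "E k \<subseteq> {0..1} \<times> UNIV" for k using \<delta> by (auto simp: E_def)
  have EM: "E k \<in> sets ?M" for k
    using Eb[of k] Om Esub[of k] by (subst sets_restrict_space_iff) auto
  have Em: "emeasure ?M (E k) = ennreal (\<delta> * V)" for k
  proof -
    have "emeasure ?M (E k) = emeasure lborel (E k)"
      using Esub[of k] Om by (intro emeasure_restrict_space) auto
    also have "\<dots> = emeasure (lborel \<Otimes>\<^sub>M lborel) (E k)" by (simp add: lborel_prod)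
    also have "\<dots> = (\<integral>\<^sup>+t. emeasure lborel (Pair t -` E k) \<partial>lborel)"
      using Eb[of k] by (intro lborel.emeasure_pair_measure_alt) (simp only: lborel_prod)
    also have "\<dots> = (\<integral>\<^sup>+t. ennreal V * indicator {0..\<delta>} t \<partial>lborel)"
    proof (rule nn_integral_cong)
      fix t
      show "emeasure lborel (Pair t -` E k) = ennreal V * indicator {0..\<delta>} t"
      proof (cases "t \<in> {0..\<delta>}")
        case True
        then have "Pair t -` E k = cball (y k - t *\<^sub>R vel k) (\<delta> / scale N)"
          by (auto simp: E_def dist_norm norm_minus_commute algebra_simps)
        then show ?thesis using True \<delta> s by (simp add: emeasure_cball V_def)
      next
        case False
        then have "Pair t -` E k = {}" by (auto simp: E_def)
        then show ?thesis using False by simp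
      qed
    qed
    also have "\<dots> = ennreal (\<delta> * V)"
      using \<delta> V by (simp add: nn_integral_cmult_indicator mult.commute flip: ennreal_mult)
    finally show ?thesis .
  qed
  have disj: "k = k'" if "z \<in> E k" "z \<in> E k'" "k \<in> K" "k' \<in> K" for z k k'
  proof (rule ccontr)
    assume ne: "k \<noteq> k'"
    obtain t x where z: "z = (t, x)" by (cases z)
    have t: "0 \<le> t" "t \<le> 1" using that \<delta> by (auto simp: E_def z)
    have "norm (y k - y k') = norm ((x - y k' + t *\<^sub>R vel k') - (x - y k + t *\<^sub>R vel k) + t *\<^sub>R (vel k - vel k'))"
      by (simp add: scaleR_diff_right)
    also have "\<dots> \<le> norm (x - y k' + t *\<^sub>R vel k') + norm (x - y k + t *\<^sub>R vel k) + norm (t *\<^sub>R (vel k - vel k'))"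
      by (intro norm_triangle_le add_mono norm_triangle_ineq4 order_refl)
    also have "norm (t *\<^sub>R (vel k - vel k')) \<le> norm (vel k - vel k')"
      using t by (simp add: mult_left_le_one_le)
    also have "norm (vel k - vel k') \<le> norm (vel k) + norm (vel k')" by (rule norm_triangle_ineq4)
    also have "norm (vel k) \<le> (\<Sum>k\<in>K. norm (vel k))" by (rule member_le_sum) (use that fin in auto)
    also have "norm (vel k') \<le> (\<Sum>k\<in>K. norm (vel k))" by (rule member_le_sum) (use that fin in auto)
    also have "norm (x - y k' + t *\<^sub>R vel k') \<le> 1"
    proof -
      have "\<delta> / scale N \<le> 1" using \<delta> s by (simp add: divide_le_eq)
      then show ?thesis using that(2) by (simp add: E_def z)
    qed
    also have "norm (x - y k + t *\<^sub>R vel k) \<le> 1"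
    proof -
      have "\<delta> / scale N \<le> 1" using \<delta> s by (simp add: divide_le_eq)
      then show ?thesis using that(1) by (simp add: E_def z)
    qed
    finally have le: "norm (y k - y k') \<le> L - 1" by (simp add: L_def)
    have L: "0 < L" by (simp add: L_def add_pos_nonneg sum_nonneg)
    have "1 \<le> norm (int_vec (k - k'))"
    proof -
      from ne obtain i where "k $ i \<noteq> k' $ i" by (auto simp: vec_eq_iff)
      then have "1 \<le> \<bar>k $ i - k' $ i\<bar>" by linarith
      then have "1 \<le> \<bar>int_vec (k - k') $ i\<bar>" by (simp add: int_vec_def flip: of_int_diff of_int_abs)
      then show ?thesis using component_le_norm_cart[of "int_vec (k - k')" i] by linarith
    qed
    then have "L * 1 \<le> norm (y k - y k')"
      using L unfolding y_def scaleR_diff_right[symmetric] int_vec_diff[symmetric] norm_scaleR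
      by (intro mult_mono) auto
    then show False using le by simp
  qed
  define w where "w = 2 ^ card K * m powr P"
  have pw: "(\<Sum>k\<in>K. ennreal w * indicator (E k) z) \<le> ennreal 2 * (\<Sum>S\<in>Pow K. ennreal (norm (F S z) powr P))" for z
  proof (cases "\<exists>k\<in>K. z \<in> E k")
    case True
    then obtain k where k: "k \<in> K" "z \<in> E k" by blast
    have uniq: "z \<in> E k' \<longleftrightarrow> k' = k" if "k' \<in> K" for k'
      using disj[OF _ k(2) that k(1)] k(2) by blast
    have "(\<Sum>k'\<in>K. ennreal w * indicator (E k') z) = (\<Sum>k'\<in>K. if k' = k then ennreal w else 0)"
      by (intro sum.cong refl) (simp add: indicator_def uniq)
    also have "\<dots> = ennreal w" using fin k by simp
    also have "\<dots> \<le> ennreal (2 ^ card K * norm (f k z) powr P)"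
    proof -
      have "m \<le> norm (f k z)"
        unfolding m_def f_def using k K by (intro packet_flow_lower) (auto simp: E_def)
      then show ?thesis unfolding w_def using m P by (intro ennreal_leI mult_left_mono powr_mono2) auto
    qed
    also have "\<dots> \<le> ennreal (2 * (\<Sum>S\<in>Pow K. norm (F S z) powr P))"
      unfolding F_eq by (intro ennreal_leI sum_signs_lower fin k P)
    also have "\<dots> = ennreal 2 * (\<Sum>S\<in>Pow K. ennreal (norm (F S z) powr P))"
      by (simp add: ennreal_mult sum_nonneg)
    finally show ?thesis .
  next
    case False
    then have "(\<Sum>k\<in>K. ennreal w * indicator (E k) z) = 0" by (intro sum.neutral) auto
    then show ?thesis by simp
  qed
  have "ennreal (real (card K) * (w * (\<delta> * V))) = (\<Sum>k\<in>K. ennreal w * emeasure ?M (E k))"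
    using \<delta> V m by (simp add: Em w_def ennreal_mult ennreal_of_nat_eq_real_of_nat)
  also have "\<dots> = (\<integral>\<^sup>+z. (\<Sum>k\<in>K. ennreal w * indicator (E k) z) \<partial>?M)"
    using EM by (subst nn_integral_sum) (auto simp: nn_integral_cmult_indicator)
  also have "\<dots> \<le> (\<integral>\<^sup>+z. ennreal 2 * (\<Sum>S\<in>Pow K. ennreal (norm (F S z) powr P)) \<partial>?M)"
    by (intro nn_integral_mono pw)
  also have "\<dots> = ennreal 2 * (\<Sum>S\<in>Pow K. \<integral>\<^sup>+z. ennreal (norm (F S z) powr P) \<partial>?M)"
    using FM by (subst nn_integral_cmult) (auto simp: nn_integral_sum simp del: sum_ennreal)
  also have "\<dots> \<le> ennreal 2 * (\<Sum>S\<in>Pow K. ennreal (D powr P))"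
    by (intro mult_left_mono sum_mono up) auto
  also have "\<dots> = ennreal (2 * (2 ^ card K * D powr P))"
    using fin by (simp add: card_Pow ennreal_mult flip: ennreal_power)
  finally have "real (card K) * (w * (\<delta> * V)) \<le> 2 * (2 ^ card K * D powr P)"
    by (simp add: ennreal_le_iff)
  then have "2 ^ card K * (real (card K) * (m powr P * (\<delta> * V))) \<le> 2 ^ card K * (2 * D powr P)"
    by (simp add: w_def mult_ac)
  then have "real (card K) * (m powr P * (\<delta> * V)) \<le> 2 * D powr P"
    by (rule mult_left_le_imp_le) simp
  then show ?thesis by (simp add: m_def V_def)
qed



section \<open>The necessary conditions\<close>


lemma concentration_exponent:
  fixes Kf :: "nat \<Rightarrow> (int ^ 'n) set"
  assumes p: "1 \<le> p" and B: "0 \<le> B"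
    and H: "\<And>N K. 1 \<le> N \<Longrightarrow> K \<subseteq> lattice_cube N \<Longrightarrow> K \<noteq> {} \<Longrightarrow>
      st_norm p (\<lambda>t. S_beta \<beta> t (inv_fourier (superpos K (\<lambda>_. 1) (\<lambda>_. 0))))
        \<le> ennreal (B * real N powr \<tau> * real (card K) powr r)"
    and Kf: "\<And>N. 1 \<le> N \<Longrightarrow> Kf N \<subseteq> lattice_cube N" "\<And>N. 1 \<le> N \<Longrightarrow> real (card (Kf N)) = real N powr x"
  shows "x + a * real CARD('n) - (2 + (a + 1) * real CARD('n)) * recip p \<le> \<tau> + x * r"
proof (rule powr_growth_le)
  show "0 < b1 * b2 powr recip p" using b1_pos b2_pos by simp
  fix N :: nat assume N: "1 \<le> N"
  then have Np: "0 < real N" by simp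
  have ne: "Kf N \<noteq> {}" using Kf(2)[OF N] Np by auto
  have "real (card (Kf N)) * b1 * scale N ^ CARD('n) *
     (b2 * real N powr (- 2 - (a + 1) * real CARD('n))) powr recip p \<le> B * real N powr \<tau> * real (card (Kf N)) powr r"
    using H[OF N Kf(1)[OF N] ne] B by (intro concentration_lower[OF Kf(1)[OF N] N p]) auto
  moreover have "scale N ^ CARD('n) = real N powr (a * real CARD('n))"
    using Np by (simp add: scale_def powr_powr flip: powr_realpow)
  ultimately have "b1 * b2 powr recip p * (real N powr x * real N powr (a * real CARD('n)) *
     real N powr ((- 2 - (a + 1) * real CARD('n)) * recip p)) \<le> B * (real N powr \<tau> * real N powr (x * r))"
    using Np b2_pos by (simp add: Kf(2)[OF N] powr_mult powr_powr mult_ac)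
  then show "b1 * b2 powr recip p * real N powr (x + a * real CARD('n) - (2 + (a + 1) * real CARD('n)) * recip p)
     \<le> B * real N powr (\<tau> + x * r)"
    unfolding powr_add[symmetric] by (simp add: algebra_simps)
qed

lemma spread_exponent:
  fixes Kf :: "nat \<Rightarrow> (int ^ 'n) set"
  assumes P: "1 \<le> P" and B: "0 \<le> B"
    and H: "\<And>N K e y. 1 \<le> N \<Longrightarrow> K \<subseteq> lattice_cube N \<Longrightarrow> K \<noteq> {} \<Longrightarrow> (\<And>k. \<bar>e k\<bar> \<le> 1) \<Longrightarrow>
      st_norm (ereal P) (\<lambda>t. S_beta \<beta> t (inv_fourier (superpos K e y)))
        \<le> ennreal (B * real N powr \<tau> * real (card K) powr r)"
    and Kf: "\<And>N. 1 \<le> N \<Longrightarrow> Kf N \<subseteq> lattice_cube N" "\<And>N. 1 \<le> N \<Longrightarrow> real (card (Kf N)) = real N powr x"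
  shows "x + a * real CARD('n) * P - a * real CARD('n) \<le> (\<tau> + x * r) * P"
proof (rule powr_growth_le)
  let ?d = "real CARD('n)"
  define b where "b = b1 powr P * (\<delta> * (unit_ball_vol ?d * \<delta> ^ CARD('n)))"
  show "0 < b" using b1_pos \<delta> by (simp add: b_def unit_ball_vol_pos)
  fix N :: nat assume "max 1 (nat \<lceil>8 * C\<rceil>) \<le> N"
  then have N: "1 \<le> N" and NC: "8 * C \<le> real N" by (auto simp: nat_le_iff ceiling_le_iff)
  then have Np: "0 < real N" by simp
  have ne: "Kf N \<noteq> {}" using Kf(2)[OF N] Np by auto
  have "real (card (Kf N)) * ((b1 * scale N ^ CARD('n)) powr P *
     (\<delta> * (unit_ball_vol ?d * (\<delta> / scale N) ^ CARD('n))))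
     \<le> 2 * (B * real N powr \<tau> * real (card (Kf N)) powr r) powr P"
    using H[OF N Kf(1)[OF N] ne] B by (intro spread_lower[OF Kf(1)[OF N] N NC P]) auto
  moreover have "scale N ^ CARD('n) = real N powr (a * ?d)"
    using Np by (simp add: scale_def powr_powr flip: powr_realpow)
  ultimately have "b * (real N powr x * real N powr (a * ?d * P) * real N powr (- (a * ?d)))
     \<le> 2 * B powr P * (real N powr (\<tau> * P) * real N powr (x * r * P))"
    using Np b1_pos B \<delta>
    by (simp add: Kf(2)[OF N] powr_mult powr_powr power_divide powr_minus b_def field_simps)
  then show "b * real N powr (x + a * ?d * P - a * ?d) \<le> 2 * B powr P * real N powr ((\<tau> + x * r) * P)"
    unfolding powr_add[symmetric] by (simp add: algebra_simps)
qed

end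

lemma alpha_BAPU_packets:
  fixes \<eta> :: "int ^ 'n \<Rightarrow> real ^ 'n \<Rightarrow> complex"
  assumes \<beta>: "0 < \<beta>" "\<beta> \<le> 2" and bapu: "alpha_BAPU (1 - \<beta> / 2) \<eta>"
  shows "\<exists>c c0 C A. dispersive_packets \<eta> (2 / \<beta> - 1) c c0 C A \<beta>"
proof -
  have a_eq: "(1 - \<beta> / 2) / (1 - (1 - \<beta> / 2)) = 2 / \<beta> - 1"
    using \<beta> by (simp add: field_simps)
  define a where "a = 2 / \<beta> - 1"
  define ctr :: "int ^ 'n \<Rightarrow> real ^ 'n" where "ctr k = jbr (int_vec k) powr a *\<^sub>R int_vec k" for k
  note b = bapu[unfolded alpha_BAPU_def Let_def a_eq, folded a_def, folded ctr_def]
  have sm: "\<And>k. smooth (\<eta> k)" using b by blast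
  from b obtain c c0 C where c: "c > 0" "c0 > 0" "C > 0"
    and low: "\<And>k \<xi>. dist \<xi> (ctr k) < c * jbr (int_vec k) powr a \<Longrightarrow> norm (\<eta> k \<xi>) \<ge> c0"
    and cl: "\<And>k. closure {\<xi>. \<eta> k \<xi> \<noteq> 0} \<subseteq> ball (ctr k) (C * jbr (int_vec k) powr a)"
    by blast
  have "\<exists>C\<gamma>. \<forall>k \<xi>. norm (pd \<gamma> (\<eta> k) \<xi>) \<le> C\<gamma> * jbr (int_vec k) powr (- (1 - \<beta> / 2) * real (length \<gamma>) / (1 - (1 - \<beta> / 2)))" for \<gamma>
    using b by blast
  then obtain Cd where Cd: "norm (pd \<gamma> (\<eta> k) \<xi>) \<le> Cd \<gamma> * jbr (int_vec k) powr (- (1 - \<beta> / 2) * real (length \<gamma>) / (1 - (1 - \<beta> / 2)))" for \<gamma> k \<xi>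
    by metis
  have ex: "- (1 - \<beta> / 2) * l / (1 - (1 - \<beta> / 2)) = - a * l" for l
    using \<beta> by (simp add: a_def field_simps)
  define G where "G = {\<gamma> :: 'n list. length \<gamma> \<le> 2 * CARD('n)}"
  have G: "finite G"
    unfolding G_def using finite_lists_length_le[of "UNIV :: 'n set" "2 * CARD('n)"] by simp
  define A where "A = (\<Sum>\<gamma>\<in>G. \<bar>Cd \<gamma>\<bar>)"
  have "dispersive_packets \<eta> a c c0 C A \<beta>"
  proof
    show "0 \<le> a" using \<beta> by (simp add: a_def field_simps)
    show "norm (\<eta> k \<xi>) \<ge> c0" if "dist \<xi> (jbr (int_vec k) powr a *\<^sub>R int_vec k) < c * jbr (int_vec k) powr a" for k \<xi>
      using that by (intro low) (simp add: ctr_def)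
    show "dist \<xi> (jbr (int_vec k) powr a *\<^sub>R int_vec k) < C * jbr (int_vec k) powr a" if "\<eta> k \<xi> \<noteq> 0" for k \<xi>
    proof -
      have "\<xi> \<in> closure {\<xi>. \<eta> k \<xi> \<noteq> 0}" using that closure_subset by fastforce
      then have "\<xi> \<in> ball (ctr k) (C * jbr (int_vec k) powr a)" using cl by blast
      then show ?thesis by (simp add: ctr_def dist_commute)
    qed
    fix k :: "int ^ 'n" and \<gamma> :: "'n list" and \<xi>
    assume l: "length \<gamma> \<le> 2 * CARD('n)"
    have "Cd \<gamma> \<le> A"
    proof -
      have "\<bar>Cd \<gamma>\<bar> \<le> A" unfolding A_def by (rule member_le_sum) (use l G in \<open>auto simp: G_def\<close>)
      then show ?thesis by simp
    qed
    then have "Cd \<gamma> * jbr (int_vec k) powr (- a * real (length \<gamma>)) \<le> A * jbr (int_vec k) powr (- a * real (length \<gamma>))"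
      by (intro mult_right_mono) auto
    then show "pd \<gamma> (\<eta> k) differentiable at \<xi> \<and> norm (pd \<gamma> (\<eta> k) \<xi>) \<le> A * jbr (int_vec k) powr (- a * real (length \<gamma>))"
      using sm[of k] Cd[of \<gamma> k \<xi>, unfolded ex] unfolding smooth_def by auto
  qed (use c \<beta> a_def in auto)
  then show ?thesis unfolding a_def by blast
qed

theorem theorem1p3:
  fixes \<eta> :: "int ^ 'n \<Rightarrow> real ^ 'n \<Rightarrow> complex"
    and \<beta> s :: real and p q :: ereal
  assumes "0 < \<beta>" "\<beta> \<le> 2"
    and "1 \<le> p" "1 \<le> q"
    and "alpha_BAPU (1 - \<beta> / 2) \<eta>"
    and "\<exists>C>0. \<forall>u :: real ^ 'n \<Rightarrow> complex.
            integrable lborel u \<and> integrable lborel (fourier u) \<longrightarrow>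
            st_norm p (\<lambda>t. S_beta \<beta> t u) \<le> ennreal C * mod_norm \<eta> (1 - \<beta> / 2) s p q u"
  shows "s \<ge> Max {0, \<beta> * real CARD('n) / 2 * (recip p - recip q),
                   \<beta> * real CARD('n) / 2 * (1 - recip p - recip q) - \<beta> * recip p}"
proof -
  let ?d = "real CARD('n)"
  define a where "a = 2 / \<beta> - 1"
  define \<sigma> where "\<sigma> = 2 * s / \<beta>"
  have \<sigma>: "s / (1 - (1 - \<beta> / 2)) = \<sigma>" by (simp add: \<sigma>_def)
  obtain c c0 C A where "dispersive_packets \<eta> a c c0 C A \<beta>"
    using alpha_BAPU_packets[OF assms(1,2,5)] unfolding a_def by blast
  then interpret dispersive_packets \<eta> a c c0 C A \<beta> .
  obtain C0 where C0: "0 < C0" and est: "\<And>u :: real ^ 'n \<Rightarrow> complex.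
      integrable lborel u \<Longrightarrow> integrable lborel (fourier u) \<Longrightarrow>
      st_norm p (\<lambda>t. S_beta \<beta> t u) \<le> ennreal C0 * mod_norm \<eta> (1 - \<beta> / 2) s p q u"
    using assms(6) by blast
  define B where "B = C0 * (W \<sigma> * B2 p * real nnear powr recip q)"
  define \<tau> where "\<tau> = \<sigma> + a * ?d * (1 - recip p)"
  have B: "0 \<le> B" using C0 by (simp add: B_def W_def B2_def)
  have H: "st_norm p (\<lambda>t. S_beta \<beta> t (inv_fourier (superpos K e y)))
      \<le> ennreal (B * real N powr \<tau> * real (card K) powr recip q)"
    if "1 \<le> N" "K \<subseteq> lattice_cube N" "K \<noteq> {}" "\<And>k. \<bar>e k\<bar> \<le> 1" for N K e y
  proof -
    have "st_norm p (\<lambda>t. S_beta \<beta> t (inv_fourier (superpos K e y)))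
       \<le> ennreal C0 * mod_norm \<eta> (1 - \<beta> / 2) s p q (inv_fourier (superpos K e y))"
      using that integrable_inv_fourier_superpos superpos_integrable
      by (intro est) (auto simp: fourier_superpos)
    also have "\<dots> \<le> ennreal C0 * ennreal (W \<sigma> * B2 p * real nnear powr recip q *
          real N powr (\<sigma> + a * ?d * (1 - recip p)) * real (card K) powr recip q)"
      using that assms(3,4) \<sigma> by (intro mult_left_mono mod_norm_superpos) auto
    also have "\<dots> = ennreal (B * real N powr \<tau> * real (card K) powr recip q)"
      using C0 by (simp add: B_def \<tau>_def mult.assoc W_def B2_def flip: ennreal_mult)
    finally show ?thesis .
  qed
  define k1 :: "nat \<Rightarrow> int ^ 'n" where "k1 N = (\<chi> i. int N)" for N
  have K1: "{k1 N} \<subseteq> lattice_cube N" "real (card {k1 N}) = real N powr 0" if "1 \<le> N" for N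
    using that by (auto simp: k1_def lattice_cube_def)
  have Kd: "(lattice_cube N :: (int ^ 'n) set) \<subseteq> lattice_cube N"
    "real (card (lattice_cube N :: (int ^ 'n) set)) = real N powr ?d" if "1 \<le> N" for N
    using that by (auto simp: card_lattice_cube powr_realpow)
  have r: "0 \<le> recip q" using recip_nonneg assms(4) by blast
  have conc: "x + a * ?d - (2 + (a + 1) * ?d) * recip p \<le> \<tau> + x * recip q"
    if "\<And>N. 1 \<le> N \<Longrightarrow> Kf N \<subseteq> lattice_cube N" "\<And>N. 1 \<le> N \<Longrightarrow> real (card (Kf N)) = real N powr x"
    for Kf :: "nat \<Rightarrow> (int ^ 'n) set" and x
    by (rule concentration_exponent[OF assms(3) B _ that]) (use H in simp)
  have third: "?d * (1 - recip p - recip q) - 2 * recip p \<le> \<sigma>"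
    using conc[OF Kd] by (simp add: \<tau>_def algebra_simps)
  have "0 \<le> \<sigma> \<and> ?d * (recip p - recip q) \<le> \<sigma>"
    using assms(3)
  proof (cases rule: ereal_ge_1_cases)
    case 1
    then have p0: "recip p = 0" by (simp add: recip_def)
    have "0 \<le> \<sigma>"
      using conc[OF K1] by (simp add: \<tau>_def p0)
    moreover have "?d * (recip p - recip q) \<le> 0" using r by (simp add: p0)
    ultimately show ?thesis by simp
  next
    case (2 P)
    then have rp: "recip p = 1 / P" "0 < P" by (simp_all add: recip_def)
    have \<tau>P: "\<tau> * P = \<sigma> * P + a * ?d * P - a * ?d"
      using rp by (simp add: \<tau>_def distrib_right right_diff_distrib left_diff_distrib)
    have spread: "x + a * ?d * P - a * ?d \<le> (\<tau> + x * recip q) * P"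
      if "\<And>N. 1 \<le> N \<Longrightarrow> Kf N \<subseteq> lattice_cube N" "\<And>N. 1 \<le> N \<Longrightarrow> real (card (Kf N)) = real N powr x"
      for Kf :: "nat \<Rightarrow> (int ^ 'n) set" and x
      by (rule spread_exponent[OF 2(2) B _ that]) (rule H[unfolded 2(1)])
    have "0 * P \<le> \<sigma> * P"
      using spread[OF K1] by (simp add: \<tau>P)
    moreover have "(?d * (recip p - recip q)) * P = ?d - ?d * recip q * P"
      using rp by (simp add: right_diff_distrib left_diff_distrib)
    then have "(?d * (recip p - recip q)) * P \<le> \<sigma> * P"
      using spread[OF Kd] unfolding distrib_right \<tau>P by linarith
    ultimately show ?thesis using rp(2) by (simp only: mult_le_cancel_right_pos)
  qed
  then have "0 * (\<beta> / 2) \<le> \<sigma> * (\<beta> / 2)" "(?d * (recip p - recip q)) * (\<beta> / 2) \<le> \<sigma> * (\<beta> / 2)"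
    "(?d * (1 - recip p - recip q) - 2 * recip p) * (\<beta> / 2) \<le> \<sigma> * (\<beta> / 2)"
    using third assms(1) by (auto intro!: mult_right_mono)
  moreover have "\<sigma> * (\<beta> / 2) = s" using assms(1) by (simp add: \<sigma>_def)
  ultimately show ?thesis by (simp add: algebra_simps)
qed

end
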